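(* Let $n\ge4$ be an integer and put $$ t_{1}=\frac{-(n-2)(2n-3)-\sqrt{3(n-2)(2n-3)}}{2(2n-1)(2n-3)},\quad t_{2}=\frac{-(n-2)(2n-3)+\sqrt{3(n-2)(2n-3)}}{2(2n-1)(2n-3)},\quad t_3=-\frac{n-3}{2(2n-3)}. $$ Then $-\frac14<t_1<t_3<t_2<0$, and, with $a_i^{\pm}=\frac12\pm\frac12\sqrt{1+4t_i}$ for $i=1,2,3$, the extremum points of the function $a\mapsto A^2_{n,3}(a)$ on $(0;1)$ are the following: $a=\frac12$ and $a_3^{\pm}$ are points of (local) minimum, and $a_1^{\pm}$, $a_2^{\pm}$ are points of (local) maximum.
   Context: For integers $n\ge1$, $0\le k\le n-1$ and $a\in(0;1)$, $A_{n,k}(a):=\sup\{|f^{(k)}(a)| : f\in \mathring{W}_2^n[0;1],\ \int_0^1|f^{(n)}(x)|^2dx\le 1\}$ and $A^2_{n,k}(a)=(A_{n,k}(a))^2$. Here $\mathring{W}_2^n[0;1]$ is the space of functions $f$ on $[0;1]$ whose derivatives up to order $n-1$ are absolutely continuous, with $f^{(n)}\in L_2[0;1]$ and $f^{(j)}(0)=f^{(j)}(1)=0$ for $j=0,\dots,n-1$. *)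

theory Defs
  imports "HOL-Analysis.Analysis"
begin

text \<open>Functions on $[0;1]$ are represented by total functions on the reals; everything below depends
  only on their values on \<open>{0..1}\<close>, derivatives at the endpoints being one-sided.\<close>

definition deriv01 :: "nat \<Rightarrow> (real \<Rightarrow> real) \<Rightarrow> real \<Rightarrow> real"
  where "deriv01 j f = ((\<lambda>g x. vector_derivative g (at x within {0..1})) ^^ j) f"

definition abs_continuous_on :: "real \<Rightarrow> real \<Rightarrow> (real \<Rightarrow> real) \<Rightarrow> bool"
  where "abs_continuous_on a b f \<longleftrightarrow>
    (\<forall>\<epsilon>>0. \<exists>\<delta>>0. \<forall>(m::nat) u v.
       (\<forall>i<m. a \<le> u i \<and> u i \<le> v i \<and> v i \<le> b) \<longrightarrow>
       disjoint_family_on (\<lambda>i. {u i<..<v i}) {..<m} \<longrightarrow>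
       (\<Sum>i<m. v i - u i) < \<delta> \<longrightarrow>
       (\<Sum>i<m. \<bar>f (v i) - f (u i)\<bar>) < \<epsilon>)"

text \<open>The derivative of order \<open>n\<close> is the almost everywhere defined derivative of the absolutely
  continuous function \<open>deriv01 (n - 1) f\<close>. That it exists almost everywhere follows from absolute
  continuity (Lebesgue); it is stated explicitly because \<^const>\<open>vector_derivative\<close> is total, with an
  arbitrary value wherever there is no derivative.\<close>

definition W0 :: "nat \<Rightarrow> (real \<Rightarrow> real) set"
  where "W0 n = {f.
    (\<forall>j. Suc j < n \<longrightarrow> deriv01 j f differentiable_on {0..1}) \<and>
    (\<forall>j<n. abs_continuous_on 0 1 (deriv01 j f)) \<and>
    (AE x in lebesgue_on {0..1}. deriv01 (n - 1) f differentiable (at x within {0..1})) \<and>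
    deriv01 n f \<in> borel_measurable (lebesgue_on {0..1}) \<and>
    integrable (lebesgue_on {0..1}) (\<lambda>x. \<bar>deriv01 n f x\<bar>\<^sup>2) \<and>
    (\<forall>j<n. deriv01 j f 0 = 0 \<and> deriv01 j f 1 = 0)}"

text \<open>For \<open>k < n\<close> and \<open>0 < a < 1\<close> the set is nonempty and bounded, so the real-valued \<^const>\<open>Sup\<close>
  is the genuine supremum.\<close>

definition A :: "nat \<Rightarrow> nat \<Rightarrow> real \<Rightarrow> real"
  where "A n k a = Sup {\<bar>deriv01 k f a\<bar> | f.
    f \<in> W0 n \<and> (LINT x|lebesgue_on {0..1}. \<bar>deriv01 n f x\<bar>\<^sup>2) \<le> 1}"

definition local_min_on :: "real set \<Rightarrow> (real \<Rightarrow> real) \<Rightarrow> real \<Rightarrow> bool"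
  where "local_min_on S F a \<longleftrightarrow> a \<in> S \<and> (\<exists>\<delta>>0. \<forall>x\<in>S. \<bar>x - a\<bar> < \<delta> \<longrightarrow> F a \<le> F x)"

definition local_max_on :: "real set \<Rightarrow> (real \<Rightarrow> real) \<Rightarrow> real \<Rightarrow> bool"
  where "local_max_on S F a \<longleftrightarrow> a \<in> S \<and> (\<exists>\<delta>>0. \<forall>x\<in>S. \<bar>x - a\<bar> < \<delta> \<longrightarrow> F x \<le> F a)"

end

(* A(n,k,a)^2 is the squared norm of the functional f |-> f^(k)(a), hence d_x^k d_y^k K(x,y) at
   x = y = a, where K is the reproducing kernel of W0 n with inner product int f^(n) g^(n). Up to
   sign, K(x,y) is for x <= y the upper half of the binomial expansion of
   (x(1-y) - y(1-x))^(2n-1) / (2n-1)!, and the sum for (d_x + d_y) K telescopes to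
     (1-x-y) (x(1-x) y(1-y))^(n-1) / (n-1)!^2,
   which is a symmetrised product of p(x) = (x(1-x))^(n-1) and q(x) = (1-2x) (x(1-x))^(n-1). So
     d/da A(n,k,a)^2 = p^(k)(a) q^(k)(a) / (n-1)!^2.
   For k = 3 this is a negative function on (0,1) times the product of a - r over the seven points
   r of the theorem, and maxima and minima alternate, beginning with a maximum at the largest r. *)

theory Submission
  imports Defs
begin

section \<open>Absolutely continuous functions\<close>

text \<open>The supremum is found without Hilbert space theory: an explicit spline representing the
  functional is exhibited, and its squared norm is its own derivative of order k at a. Verifying
  this needs integration by parts for functions whose top derivative exists only almost everywhere,
  hence the integral theorem for absolutely continuous functions.

  The expansion is in x(1-y) and y(1-x), although their difference is just x-y, because every term
  of the upper half then contains x^n and (1-y)^n, so the boundary conditions hold term by term; the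
  two branches of K differ by a multiple of (x-y)^(2n-1), which supplies the single jump.

  On the diagonal d/da acts as d_x + d_y, and this operator commutes with d_x^k d_y^k. Hence (d_x +
  d_y) K is computed once for all k, and the k derivatives in each variable fall on products of
  one-variable functions. Two-variable identities are used as polynomial identities in one variable
  with the other one frozen.\<close>

definition ac_modulus :: "real \<Rightarrow> real \<Rightarrow> (real \<Rightarrow> real) \<Rightarrow> real \<Rightarrow> real \<Rightarrow> bool"
  where "ac_modulus a b f \<epsilon> \<delta> \<longleftrightarrow> (\<forall>(m::nat) u v.
       (\<forall>i<m. a \<le> u i \<and> u i \<le> v i \<and> v i \<le> b) \<longrightarrow>
       disjoint_family_on (\<lambda>i. {u i<..<v i}) {..<m} \<longrightarrow>
       (\<Sum>i<m. v i - u i) < \<delta> \<longrightarrow>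
       (\<Sum>i<m. \<bar>f (v i) - f (u i)\<bar>) < \<epsilon>)"

lemma abs_continuous_on_modulus:
  "abs_continuous_on a b f \<longleftrightarrow> (\<forall>\<epsilon>>0. \<exists>\<delta>>0. ac_modulus a b f \<epsilon> \<delta>)"
  unfolding abs_continuous_on_def ac_modulus_def ..

lemma ac_modulusI:
  assumes "\<And>(m::nat) u v. (\<And>i. i < m \<Longrightarrow> a \<le> u i \<and> u i \<le> v i \<and> v i \<le> b) \<Longrightarrow>
    disjoint_family_on (\<lambda>i. {u i<..<v i}) {..<m} \<Longrightarrow> (\<Sum>i<m. v i - u i) < \<delta> \<Longrightarrow>
    (\<Sum>i<m. \<bar>f (v i) - f (u i)\<bar>) < \<epsilon>"
  shows "ac_modulus a b f \<epsilon> \<delta>"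
  using assms unfolding ac_modulus_def by auto

lemma ac_modulusD:
  fixes m :: nat
  assumes "ac_modulus a b f \<epsilon> \<delta>" "\<And>i. i < m \<Longrightarrow> a \<le> u i \<and> u i \<le> v i \<and> v i \<le> b"
    "disjoint_family_on (\<lambda>i. {u i<..<v i}) {..<m}" "(\<Sum>i<m. v i - u i) < \<delta>"
  shows "(\<Sum>i<m. \<bar>f (v i) - f (u i)\<bar>) < \<epsilon>"
  using assms unfolding ac_modulus_def by auto

lemma abs_continuous_on_subinterval:
  assumes "abs_continuous_on a b f" "a \<le> c" "d \<le> b"
  shows "abs_continuous_on c d f"
  unfolding abs_continuous_on_modulus
proof (intro allI impI)
  fix e :: real assume "e > 0"
  then obtain \<delta> where \<delta>: "\<delta> > 0" "ac_modulus a b f e \<delta>"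
    using assms(1) unfolding abs_continuous_on_modulus by blast
  have "ac_modulus c d f e \<delta>"
  proof (rule ac_modulusI)
    fix m :: nat and u v
    assume "\<And>i. i < m \<Longrightarrow> c \<le> u i \<and> u i \<le> v i \<and> v i \<le> d"
    hence "\<And>i. i < m \<Longrightarrow> a \<le> u i \<and> u i \<le> v i \<and> v i \<le> b"
      using assms(2,3) by (meson order.trans)
    moreover assume "disjoint_family_on (\<lambda>i. {u i<..<v i}) {..<m}" "(\<Sum>i<m. v i - u i) < \<delta>"
    ultimately show "(\<Sum>i<m. \<bar>f (v i) - f (u i)\<bar>) < e" by (rule ac_modulusD[OF \<delta>(2)])
  qed
  thus "\<exists>\<delta>>0. ac_modulus c d f e \<delta>" using \<delta>(1) by blast
qed

lemma lipschitz_imp_abs_continuous_on: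
  assumes "L-lipschitz_on {a..b} f"
  shows "abs_continuous_on a b f"
  unfolding abs_continuous_on_modulus
proof (intro allI impI)
  fix e :: real assume e: "e > 0"
  have L: "L \<ge> 0" using assms by (rule lipschitz_on_nonneg)
  \<comment> \<open>\<open>L + 1\<close> rather than \<open>L\<close>, since a Lipschitz constant
    may be 0.\<close>
  have "ac_modulus a b f e (e / (L + 1))"
  proof (rule ac_modulusI)
    fix m :: nat and u v
    assume uv: "\<And>i. i < m \<Longrightarrow> a \<le> u i \<and> u i \<le> v i \<and> v i \<le> b"
      and d: "(\<Sum>i<m. v i - u i) < e / (L + 1)"
    have "(\<Sum>i<m. \<bar>f (v i) - f (u i)\<bar>) \<le> (\<Sum>i<m. (L + 1) * (v i - u i))"
    proof (rule sum_mono)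
      fix i assume "i \<in> {..<m}"
      hence "a \<le> u i \<and> u i \<le> v i \<and> v i \<le> b" using uv by auto
      hence "\<bar>f (v i) - f (u i)\<bar> \<le> L * (v i - u i)" "v i - u i \<ge> 0"
        using lipschitz_onD[OF assms, of "v i" "u i"] by (auto simp: dist_real_def)
      thus "\<bar>f (v i) - f (u i)\<bar> \<le> (L + 1) * (v i - u i)" by (simp add: algebra_simps)
    qed
    also have "\<dots> = (L + 1) * (\<Sum>i<m. v i - u i)" by (rule sum_distrib_left[symmetric])
    also have "\<dots> < e" using d L by (simp add: pos_less_divide_eq mult.commute)
    finally show "(\<Sum>i<m. \<bar>f (v i) - f (u i)\<bar>) < e" .
  qed
  moreover have "e / (L + 1) > 0" using e L by simp
  ultimately show "\<exists>\<delta>>0. ac_modulus a b f e \<delta>" by blast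
qed

lemma abs_continuous_on_imp_continuous_on:
  assumes "abs_continuous_on a b f"
  shows "continuous_on {a..b} f"
proof (rule continuous_onI)
  fix x and e :: real assume x: "x \<in> {a..b}" and "e > 0"
  then obtain d where d: "d > 0" "ac_modulus a b f e d"
    using assms unfolding abs_continuous_on_modulus by blast
  show "\<exists>d>0. \<forall>x'\<in>{a..b}. dist x' x < d \<longrightarrow> dist (f x') (f x) \<le> e"
  proof (intro exI[of _ d] conjI ballI impI)
    fix y assume y: "y \<in> {a..b}" "dist y x < d"
    show "dist (f y) (f x) \<le> e"
      using ac_modulusD[OF d(2), of "Suc 0" "\<lambda>_. min x y" "\<lambda>_. max x y"] x y
      by (cases "x \<le> y") (auto simp: dist_real_def disjoint_family_on_def abs_minus_commute)
  qed (fact d(1))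
qed

text \<open>The one epsilon-delta argument behind the closure properties: sums and products only
  have to bound a single increment. With \<open>g\<close> constant it also transfers absolute
  continuity to a function that agrees with \<open>f\<close> on the interval.\<close>

lemma abs_continuous_on_dominated:
  assumes f: "abs_continuous_on a b f" and g: "abs_continuous_on a b g" and C: "C > 0"
    and h: "\<And>u v. a \<le> u \<Longrightarrow> u \<le> v \<Longrightarrow> v \<le> b \<Longrightarrow>
      \<bar>h v - h u\<bar> \<le> C * (\<bar>f v - f u\<bar> + \<bar>g v - g u\<bar>)"
  shows "abs_continuous_on a b h"
  unfolding abs_continuous_on_modulus
proof (intro allI impI)
  fix e :: real assume e: "e > 0"
  hence e': "e / (2 * C) > 0" using C by simp
  obtain d1 where d1: "d1 > 0" "ac_modulus a b f (e / (2 * C)) d1"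
    using f e' unfolding abs_continuous_on_modulus by blast
  obtain d2 where d2: "d2 > 0" "ac_modulus a b g (e / (2 * C)) d2"
    using g e' unfolding abs_continuous_on_modulus by blast
  have "ac_modulus a b h e (min d1 d2)"
  proof (rule ac_modulusI)
    fix m :: nat and u v
    assume uv: "\<And>i. i < m \<Longrightarrow> a \<le> u i \<and> u i \<le> v i \<and> v i \<le> b"
      and disj: "disjoint_family_on (\<lambda>i. {u i<..<v i}) {..<m}"
      and d: "(\<Sum>i<m. v i - u i) < min d1 d2"
    have "(\<Sum>i<m. \<bar>h (v i) - h (u i)\<bar>)
        \<le> (\<Sum>i<m. C * (\<bar>f (v i) - f (u i)\<bar> + \<bar>g (v i) - g (u i)\<bar>))"
      by (rule sum_mono) (use uv h in auto)
    also have "\<dots> = C * ((\<Sum>i<m. \<bar>f (v i) - f (u i)\<bar>) + (\<Sum>i<m. \<bar>g (v i) - g (u i)\<bar>))"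
      by (simp only: sum_distrib_left[symmetric] sum.distrib)
    also have "\<dots> < C * (e / (2 * C) + e / (2 * C))"
      using C ac_modulusD[OF d1(2) uv disj] ac_modulusD[OF d2(2) uv disj] d
      by (intro mult_strict_left_mono add_strict_mono) auto
    also have "\<dots> = e" using C by simp
    finally show "(\<Sum>i<m. \<bar>h (v i) - h (u i)\<bar>) < e" .
  qed
  moreover have "min d1 d2 > 0" using d1 d2 by simp
  ultimately show "\<exists>\<delta>>0. ac_modulus a b h e \<delta>" by blast
qed

lemma abs_continuous_on_add:
  assumes "abs_continuous_on a b f" "abs_continuous_on a b g"
  shows "abs_continuous_on a b (\<lambda>x. f x + g x)"
  by (rule abs_continuous_on_dominated[OF assms, of 1]) auto

lemma abs_continuous_on_mult:
  assumes "abs_continuous_on a b f" "abs_continuous_on a b g"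
  shows "abs_continuous_on a b (\<lambda>x. f x * g x)"
proof -
  have "\<exists>B. \<forall>x\<in>{a..b}. \<bar>h x\<bar> \<le> B" if "abs_continuous_on a b h" for h :: "real \<Rightarrow> real"
    using compact_imp_bounded[OF compact_continuous_image
        [OF abs_continuous_on_imp_continuous_on[OF that] compact_Icc]]
    by (auto simp: bounded_iff)
  then obtain B1 B2 where B: "\<forall>x\<in>{a..b}. \<bar>f x\<bar> \<le> B1" "\<forall>x\<in>{a..b}. \<bar>g x\<bar> \<le> B2"
    using assms by meson
  define C where "C = max 1 (max B1 B2)"
  have C: "C > 0" "\<And>x. x \<in> {a..b} \<Longrightarrow> \<bar>f x\<bar> \<le> C" "\<And>x. x \<in> {a..b} \<Longrightarrow> \<bar>g x\<bar> \<le> C"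
    using B by (fastforce simp: C_def)+
  show ?thesis
  proof (rule abs_continuous_on_dominated[OF assms C(1)])
    fix u v assume uv: "a \<le> u" "u \<le> v" "v \<le> b"
    have "\<bar>f v * g v - f u * g u\<bar> = \<bar>(f v - f u) * g v + f u * (g v - g u)\<bar>"
      by (simp add: algebra_simps)
    also have "\<dots> \<le> \<bar>f v - f u\<bar> * \<bar>g v\<bar> + \<bar>f u\<bar> * \<bar>g v - g u\<bar>"
      by (metis abs_mult abs_triangle_ineq)
    also have "\<dots> \<le> \<bar>f v - f u\<bar> * C + C * \<bar>g v - g u\<bar>"
      using C(2)[of u] C(3)[of v] uv by (intro add_mono mult_left_mono mult_right_mono) auto
    finally show "\<bar>f v * g v - f u * g u\<bar> \<le> C * (\<bar>f v - f u\<bar> + \<bar>g v - g u\<bar>)"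
      by (simp add: algebra_simps)
  qed
qed

lemma abs_continuous_on_const: "abs_continuous_on a b (\<lambda>_. c)"
  unfolding abs_continuous_on_def by (auto intro: exI[of _ 1])

lemma abs_continuous_on_sum:
  assumes "\<And>i. i \<in> I \<Longrightarrow> abs_continuous_on a b (f i)"
  shows "abs_continuous_on a b (\<lambda>x. \<Sum>i\<in>I. f i x)"
  using assms
  by (induction I rule: infinite_finite_induct)
    (auto intro: abs_continuous_on_add abs_continuous_on_const)

lemma lipschitz_on_poly: "\<exists>L. L-lipschitz_on {a..b} (poly p)" for a b :: real
proof -
  have "bounded (poly (pderiv p) ` {a..b})"
    by (intro compact_imp_bounded compact_continuous_image continuous_on_poly continuous_on_id compact_Icc)
  then obtain B where B: "\<And>x. x \<in> {a..b} \<Longrightarrow> \<bar>poly (pderiv p) x\<bar> \<le> B"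
    unfolding bounded_iff by (auto simp del: atLeastAtMost_iff)
  have "(max 0 B)-lipschitz_on {a..b} (poly p)"
  proof (rule bounded_derivative_imp_lipschitz)
    fix x assume x: "x \<in> {a..b}"
    show "(poly p has_derivative (\<lambda>h. h * poly (pderiv p) x)) (at x within {a..b})"
      using poly_DERIV[of p x] by (simp add: has_field_derivative_def mult_commute_abs has_derivative_at_withinI)
    show "onorm (\<lambda>h. h * poly (pderiv p) x) \<le> max 0 B"
      using B[OF x] by (intro onorm_le) (subst mult.commute, auto simp: abs_mult intro!: mult_right_mono)
  qed auto
  thus ?thesis by blast
qed

lemma abs_continuous_on_poly: "abs_continuous_on a b (poly p)"
  using lipschitz_on_poly lipschitz_imp_abs_continuous_on by blast

text \<open>The gauge at the points
  of the exceptional null set keeps the tagged intervals inside an open set of small measure, where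
  absolute continuity bounds the increments.\<close>

theorem abs_continuous_on_has_integral:
  assumes ab: "a \<le> b" and ac: "abs_continuous_on a b f" and E: "negligible E"
    and der: "\<And>x. x \<in> {a..b} - E \<Longrightarrow> (f has_vector_derivative f' x) (at x within {a..b})"
  shows "(f' has_integral (f b - f a)) {a..b}"
proof -
  \<comment> \<open>With value 0 on \<open>E\<close>, a tag in \<open>E\<close> adds nothing to the
    Riemann sum, so only the increment of \<open>f\<close> over its interval remains to be
    estimated.\<close>
  define g where "g x = (if x \<in> E then 0 else f' x)" for x
  have "(g has_integral (f b - f a)) {a..b}"
    unfolding has_integral_real
  proof (intro allI impI)
    fix e :: real assume e: "e > 0"
    \<comment> \<open>\<open>b - a + 1\<close> keeps the divisor positive when
      \<open>a = b\<close>.\<close>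
    define e1 where "e1 = e / (2 * (b - a + 1))"
    have e1: "e1 > 0" using e ab by (simp add: e1_def)
    have "\<exists>d>0. x \<in> {a..b} - E \<longrightarrow>
         (\<forall>y\<in>{a..b}. \<bar>y-x\<bar> < d \<longrightarrow> \<bar>f y - f x - (y-x) * g x\<bar> \<le> e1 * \<bar>y-x\<bar>)" for x
    proof (cases "x \<in> {a..b} - E")
      case True
      hence "(f has_derivative (\<lambda>h. h *\<^sub>R g x)) (at x within {a..b})"
        using der[of x] by (simp add: g_def has_vector_derivative_def)
      thus ?thesis using e1 unfolding has_derivative_within_alt by auto
    qed (auto intro: exI[of _ 1])
    then obtain d where d: "\<And>x. 0 < d x"
        "\<And>x y. x \<in> {a..b} - E \<Longrightarrow> y \<in> {a..b} \<Longrightarrow> \<bar>y-x\<bar> < d x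
           \<Longrightarrow> \<bar>f y - f x - (y-x) * g x\<bar> \<le> e1 * \<bar>y-x\<bar>"
      by metis
    obtain \<delta> where \<delta>: "\<delta> > 0" "ac_modulus a b f (e / 2) \<delta>"
      using ac half_gt_zero[OF e] unfolding abs_continuous_on_modulus by blast
    have Enull: "E \<in> null_sets lebesgue" using E by (simp add: negligible_iff_null_sets)
    then obtain U where U: "open U" "E \<subseteq> U" "U - E \<in> lmeasurable"
        "emeasure lebesgue (U - E) < ennreal \<delta>"
      using sets_lebesgue_outer_open[of E \<delta>] \<delta>(1) by blast
    have Um: "U \<in> lmeasurable" "measure lebesgue U < \<delta>"
    proof -
      have "U = (U - E) \<union> E" using U by auto
      hence "emeasure lebesgue U = emeasure lebesgue (U - E)"
        using Enull U(3) by (metis emeasure_Un_null_set fmeasurableD)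
      hence em: "emeasure lebesgue U < ennreal \<delta>" using U(4) by simp
      thus Ul: "U \<in> lmeasurable" using U(1)
        by (intro fmeasurableI) (auto simp: less_top[symmetric] intro: order.strict_trans)
      show "measure lebesgue U < \<delta>"
        using em \<delta>(1) emeasure_eq_measure2[OF Ul] by (simp add: ennreal_less_iff)
    qed
    define \<gamma> where "\<gamma> x = (if x \<in> E then U else ball x (d x))" for x
    have "gauge \<gamma>" using U d(1) by (auto simp: gauge_def \<gamma>_def)
    moreover have "norm (sum (\<lambda>(x,k). measure lborel k *\<^sub>R g x) p - (f b - f a)) < e"
      if p: "p tagged_division_of {a..b}" "\<gamma> fine p" for p
    proof -
      note fin = tagged_division_of_finite[OF p(1)]
      have K: "\<exists>u v. k = {u..v} \<and> u \<le> v \<and> x \<in> {u..v} \<and> a \<le> u \<and> v \<le> b" if "(x,k) \<in> p" for x k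
        using tagged_division_ofD(2,3,4)[OF p(1)[folded box_real] that] by (force simp: subset_iff)
      define pE where "pE = {q \<in> p. fst q \<in> E}"
      let ?D = "\<lambda>(x,k). measure lborel k * g x - (f (Sup k) - f (Inf k))"
      have "sum (\<lambda>(x,k). measure lborel k *\<^sub>R g x) p - (f b - f a) = sum ?D p"
        using additive_tagged_division_1[OF ab p(1), of f]
        by (simp add: case_prod_beta sum_subtractf)
      also have "\<dots> = sum ?D pE + sum ?D (p - pE)"
        using fin sum.subset_diff[of pE p ?D] by (auto simp: pE_def)
      finally have split: "sum (\<lambda>(x,k). measure lborel k *\<^sub>R g x) p - (f b - f a) = sum ?D pE + sum ?D (p - pE)" .
      have "\<bar>sum ?D (p - pE)\<bar> \<le> (\<Sum>(x,k)\<in>p - pE. e1 * measure lborel k)"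
        unfolding real_norm_def[symmetric]
      proof (rule sum_norm_le, safe)
        fix x k assume xk: "(x,k) \<in> p" "(x,k) \<notin> pE"
        then obtain u v where k: "k = {u..v}" "u \<le> v" "x \<in> {u..v}" "a \<le> u" "v \<le> b"
          using K by blast
        have x: "x \<in> {a..b} - E" using xk k by (auto simp: pE_def)
        have "k \<subseteq> \<gamma> x" using p(2) xk(1) by (auto simp: fine_def)
        hence "k \<subseteq> ball x (d x)" using x by (simp add: \<gamma>_def)
        moreover have "u \<in> k" "v \<in> k" using k by auto
        ultimately have "u \<in> ball x (d x)" "v \<in> ball x (d x)" by blast+
        hence "\<bar>f u - f x - (u-x) * g x\<bar> \<le> e1 * \<bar>u-x\<bar>" "\<bar>f v - f x - (v-x) * g x\<bar> \<le> e1 * \<bar>v-x\<bar>"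
          using d(2)[OF x, of u] d(2)[OF x, of v] k by (simp_all add: dist_real_def)
        \<comment> \<open>The tag lies between \<open>u\<close> and \<open>v\<close>, so the two
          linearisation errors measured from \<open>x\<close> add up to at most a multiple of
          \<open>v - u\<close>.\<close>
        moreover have "(v - u) * g x - (f v - f u) = (f u - f x - (u-x) * g x) - (f v - f x - (v-x) * g x)"
          by (simp add: algebra_simps)
        moreover have "e1 * \<bar>u-x\<bar> + e1 * \<bar>v-x\<bar> = e1 * (v - u)" using k by (simp add: algebra_simps)
        ultimately have "\<bar>(v - u) * g x - (f v - f u)\<bar> \<le> e1 * (v - u)" by linarith
        thus "norm (measure lborel k * g x - (f (Sup k) - f (Inf k))) \<le> e1 * measure lborel k"
          using k by simp
      qed
      also have "\<dots> \<le> (\<Sum>(x,k)\<in>p. e1 * measure lborel k)"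
        using fin e1 by (intro sum_mono2) auto
      also have "\<dots> = e1 * (b - a)"
        using additive_content_tagged_division[OF p(1)[folded box_real]] ab
        by (simp add: sum_distrib_left[symmetric] case_prod_beta)
      also have "\<dots> < e / 2"
      proof -
        have "e1 * (b - a) < e1 * (b - a + 1)" using e1 by simp
        also have "\<dots> = e / 2" using ab by (simp add: e1_def field_simps)
        finally show ?thesis .
      qed
      finally have 1: "\<bar>sum ?D (p - pE)\<bar> < e / 2" .
      have finE: "finite pE" using fin by (simp add: pE_def)
      \<comment> \<open>\<open>ac_modulus\<close> speaks of families indexed by the numbers below
        \<open>m\<close>, so the pairs with tag in \<open>E\<close> are enumerated.\<close>
      obtain h where h: "bij_betw h {..<card pE} pE"
        using ex_bij_betw_nat_finite[OF finE] by (auto simp: atLeast0LessThan)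
      define u v where "u i = Inf (snd (h i))" and "v i = Sup (snd (h i))" for i
      have uv: "a \<le> u i \<and> u i \<le> v i \<and> v i \<le> b" "snd (h i) = {u i..v i}" "{u i..v i} \<subseteq> U"
        "h i \<in> p" if "i < card pE" for i
      proof -
        have hi: "h i \<in> pE" using h that by (auto simp: bij_betw_def)
        hence hip: "(fst (h i), snd (h i)) \<in> p" "fst (h i) \<in> E" by (auto simp: pE_def)
        from K[OF this(1)] obtain u' v' where k: "snd (h i) = {u'..v'}" "u' \<le> v'" "a \<le> u'" "v' \<le> b"
          by auto
        thus *: "a \<le> u i \<and> u i \<le> v i \<and> v i \<le> b" "snd (h i) = {u i..v i}"
          by (auto simp: u_def v_def)
        have "snd (h i) \<subseteq> \<gamma> (fst (h i))" using p(2) hip(1) unfolding fine_def by blast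
        thus "{u i..v i} \<subseteq> U" using hip(2) *(2) by (simp add: \<gamma>_def)
        show "h i \<in> p" using hip by simp
      qed
      have disj: "{u i<..<v i} \<inter> {u j<..<v j} = {}" if "i < card pE" "j < card pE" "i \<noteq> j" for i j
      proof -
        have "h i \<noteq> h j" using h that by (auto simp: bij_betw_def inj_on_def)
        hence "interior (snd (h i)) \<inter> interior (snd (h j)) = {}"
          using tagged_division_ofD(5)[OF p(1), of "fst (h i)" "snd (h i)" "fst (h j)" "snd (h j)"]
            uv(4) that by simp
        thus ?thesis using uv(2) that by simp
      qed
      have "(\<Sum>i<card pE. v i - u i) = (\<Sum>i<card pE. measure lebesgue {u i<..<v i})"
        using uv(1) by (intro sum.cong) auto
      also have "\<dots> = measure lebesgue (\<Union>i<card pE. {u i<..<v i})"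
        using disj by (intro measure_negligible_finite_Union_image[symmetric])
          (auto simp: pairwise_def)
      also have "\<dots> \<le> measure lebesgue U"
        using uv(3) Um(1) by (intro measure_mono_fmeasurable) (auto, fastforce)
      also have "\<dots> < \<delta>" by (fact Um(2))
      finally have "(\<Sum>i<card pE. \<bar>f (v i) - f (u i)\<bar>) < e / 2"
        using uv(1) disj by (intro ac_modulusD[OF \<delta>(2)]) (auto simp: disjoint_family_on_def)
      moreover have "\<bar>sum ?D pE\<bar> \<le> (\<Sum>i<card pE. \<bar>f (v i) - f (u i)\<bar>)"
      proof -
        have "sum ?D pE = (\<Sum>i<card pE. ?D (h i))"
          by (rule sum.reindex_bij_betw[OF h, symmetric])
        also have "\<dots> = (\<Sum>i<card pE. - (f (v i) - f (u i)))"
        proof (rule sum.cong)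
          fix i assume "i \<in> {..<card pE}"
          hence "fst (h i) \<in> E" using h by (auto simp: bij_betw_def pE_def)
          thus "?D (h i) = - (f (v i) - f (u i))"
            by (simp add: case_prod_beta g_def u_def v_def)
        qed simp
        finally show ?thesis by (metis (no_types, lifting) abs_minus_cancel sum_abs sum.cong)
      qed
      ultimately show ?thesis unfolding split real_norm_def using 1 by linarith
    qed
    ultimately show "\<exists>\<gamma>. gauge \<gamma> \<and> (\<forall>p. p tagged_division_of {a..b} \<and> \<gamma> fine p \<longrightarrow>
        norm (sum (\<lambda>(x,k). measure lborel k *\<^sub>R g x) p - (f b - f a)) < e)"
      by (intro exI[of _ \<gamma>] conjI allI impI) simp_all
  qed
  thus ?thesis by (rule has_integral_spike[OF E, rotated]) (auto simp: g_def)
qed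

section \<open>The space \<open>W0\<close> and the extremal spline\<close>

lemma deriv01_0 [simp]: "deriv01 0 f = f"
  and deriv01_Suc: "deriv01 (Suc j) f x = vector_derivative (deriv01 j f) (at x within {0..1})"
  by (simp_all add: deriv01_def)

lemma deriv01_SucI:
  assumes "x \<in> {0..1}" "\<And>y. y \<in> {0..1} \<Longrightarrow> deriv01 j f y = g y"
    and "(g has_vector_derivative d) (at x within {0..1})"
  shows "deriv01 (Suc j) f x = d" "(deriv01 j f has_vector_derivative d) (at x within {0..1})"
proof -
  show *: "(deriv01 j f has_vector_derivative d) (at x within {0..1})"
    using assms by (intro has_vector_derivative_transform[OF assms(1) _ assms(3)]) auto
  show "deriv01 (Suc j) f x = d"
    using vector_derivative_within_cbox[of 0 1 x "deriv01 j f" d] * assms(1)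
    by (auto simp: deriv01_Suc)
qed

lemma W0_has_vector_derivative:
  assumes "f \<in> W0 n" "Suc j < n" "x \<in> {0..1}"
  shows "(deriv01 j f has_vector_derivative deriv01 (Suc j) f x) (at x within {0..1})"
  using assms unfolding W0_def
  by (auto simp: deriv01_Suc differentiable_on_def vector_derivative_works[symmetric])

lemma W0_has_vector_derivative_AE:
  assumes "f \<in> W0 (Suc m)"
  obtains E where "negligible E" "\<And>x. x \<in> {0..1} - E \<Longrightarrow>
    (deriv01 m f has_vector_derivative deriv01 (Suc m) f x) (at x within {0..1})"
proof -
  have "AE x in lebesgue_on {0..1}. deriv01 m f differentiable (at x within {0..1})"
    using assms by (simp add: W0_def)
  hence "AE x in lebesgue. x \<in> {0..1} \<longrightarrow> deriv01 m f differentiable (at x within {0..1})"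
    by (subst (asm) AE_restrict_space_iff) auto
  then obtain E where E: "E \<in> null_sets lebesgue"
      "\<And>x. x \<in> {0..1} - E \<Longrightarrow> deriv01 m f differentiable (at x within {0..1})"
    by (auto elim!: AE_E3)
  show ?thesis
  proof (rule that[of E])
    show "negligible E" using E by (simp add: negligible_iff_null_sets)
  qed (use E in \<open>auto simp: deriv01_Suc vector_derivative_works[symmetric]\<close>)
qed

text \<open>All \<open>n\<close> integrations by parts at once: \<open>\<Phi>\<close> collects the
  boundary terms, and its derivative telescopes to the integrand minus a last term containing the
  derivative of \<open>q\<close> of order \<open>n\<close>, which is 0. The sum
  \<open>\<Phi>\<close> is absolutely continuous, so differentiability off a null set is
  enough.\<close>

lemma W0_by_parts:
  assumes f: "f \<in> W0 n" and n: "n > 0" and cd: "0 \<le> c" "c \<le> d" "d \<le> 1"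
    and q: "(pderiv ^^ n) q = 0"
  defines "\<Phi> \<equiv> \<lambda>x. \<Sum>j<n. (-1) ^ j * deriv01 (n - Suc j) f x * poly ((pderiv ^^ j) q) x"
  shows "((\<lambda>x. deriv01 n f x * poly q x) has_integral (\<Phi> d - \<Phi> c)) {c..d}"
proof -
  obtain m where m: "n = Suc m" using n by (cases n) auto
  obtain E where E: "negligible E" "\<And>x. x \<in> {0..1} - E \<Longrightarrow>
    (deriv01 m f has_vector_derivative deriv01 n f x) (at x within {0..1})"
    using W0_has_vector_derivative_AE f unfolding m by metis
  show ?thesis
  proof (rule abs_continuous_on_has_integral[OF cd(2) _ E(1)])
    have "abs_continuous_on 0 1 \<Phi>"
      unfolding \<Phi>_def using f
      by (intro abs_continuous_on_sum abs_continuous_on_mult abs_continuous_on_const abs_continuous_on_poly)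
         (auto simp: W0_def)
    thus "abs_continuous_on c d \<Phi>" by (rule abs_continuous_on_subinterval) (use cd in auto)
  next
    fix x assume x: "x \<in> {c..d} - E"
    define T where "T j = (-1) ^ j * deriv01 (n - j) f x * poly ((pderiv ^^ j) q) x" for j
    have "(\<Phi> has_vector_derivative (\<Sum>j<n. T j - T (Suc j))) (at x within {0..1})"
      unfolding \<Phi>_def
    proof (rule has_vector_derivative_sum)
      fix j assume j: "j \<in> {..<n}"
      hence nj: "Suc (n - Suc j) = n - j" by auto
      have "(deriv01 (n - Suc j) f has_vector_derivative deriv01 (n - j) f x) (at x within {0..1})"
      \<comment> \<open>Only the term \<open>j = 0\<close> differentiates the derivative of order
        \<open>n - 1\<close>; it alone needs \<open>x\<close> to avoid \<open>E\<close>.\<close>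
      proof (cases "j = 0")
        case True
        thus ?thesis using E(2)[of x] x cd m by auto
      next
        case False
        thus ?thesis using W0_has_vector_derivative[OF f, of "n - Suc j" x] j x cd nj by auto
      qed
      hence 1: "(deriv01 (n - Suc j) f has_field_derivative deriv01 (n - j) f x) (at x within {0..1})"
        by (simp add: has_real_derivative_iff_has_vector_derivative)
      have 2: "(poly ((pderiv ^^ j) q) has_field_derivative poly ((pderiv ^^ Suc j) q) x) (at x within {0..1})"
        using poly_DERIV[of "(pderiv ^^ j) q" x] by (auto intro: has_field_derivative_at_within)
      show "((\<lambda>x. (-1) ^ j * deriv01 (n - Suc j) f x * poly ((pderiv ^^ j) q) x)
          has_vector_derivative T j - T (Suc j)) (at x within {0..1})"
        unfolding has_real_derivative_iff_has_vector_derivative[symmetric] T_def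
        by (rule derivative_eq_intros 1 2 refl | simp add: algebra_simps)+
    qed
    also have "(\<Sum>j<n. T j - T (Suc j)) = T 0 - T n" by (rule sum_lessThan_telescope')
    also have "\<dots> = deriv01 n f x * poly q x" by (simp add: T_def q)
    finally show "(\<Phi> has_vector_derivative deriv01 n f x * poly q x) (at x within {c..d})"
      by (rule has_vector_derivative_within_subset) (use cd in auto)
  qed
qed

section \<open>Two polynomials joined at a point\<close>

definition glue :: "real \<Rightarrow> real poly \<Rightarrow> real poly \<Rightarrow> real \<Rightarrow> real"
  where "glue a L R x = (if x \<le> a then poly L x else poly R x)"

lemma has_vector_derivative_glue:
  assumes "poly L a = poly R a" "x = a \<Longrightarrow> poly (pderiv L) a = poly (pderiv R) a"
  shows "(glue a L R has_vector_derivative glue a (pderiv L) (pderiv R) x) (at x within {0..1})"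
proof -
  have *: "(poly p has_vector_derivative poly (pderiv p) x) (at x within S)" for p :: "real poly" and S
    using poly_DERIV[of p x]
    by (auto simp: has_real_derivative_iff_has_vector_derivative intro: has_vector_derivative_at_within)
  have "((\<lambda>x. if x \<in> {..a} then poly L x else poly R x) has_vector_derivative
      (if x \<in> {..a} then poly (pderiv L) x else poly (pderiv R) x)) (at x within UNIV)"
    by (rule has_vector_derivative_If_within_closures[where T = "{a..}"]) (use assms * in auto)
  hence "(glue a L R has_vector_derivative glue a (pderiv L) (pderiv R) x) (at x)"
    by (simp add: glue_def[abs_def])
  thus ?thesis by (rule has_vector_derivative_at_within)
qed

text \<open>Induction with \<open>has_vector_derivative_glue\<close>. Agreement in order
  \<open>j\<close> itself is asked for only at \<open>x = a\<close>, so that the derivative of order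
  \<open>n\<close> of a spline is still available off \<open>a\<close> when its two pieces part in
  that order.\<close>

lemma deriv01_glue:
  assumes "\<And>i. i < j \<Longrightarrow> poly ((pderiv ^^ i) L) a = poly ((pderiv ^^ i) R) a"
    and "x \<in> {0..1}" "x = a \<Longrightarrow> poly ((pderiv ^^ j) L) a = poly ((pderiv ^^ j) R) a"
  shows "deriv01 j (glue a L R) x = glue a ((pderiv ^^ j) L) ((pderiv ^^ j) R) x"
  using assms
proof (induction j arbitrary: x)
  case (Suc j)
  have "deriv01 j (glue a L R) y = glue a ((pderiv ^^ j) L) ((pderiv ^^ j) R) y" if "y \<in> {0..1}" for y
    using Suc.prems that by (intro Suc.IH) auto
  from deriv01_SucI(1)[OF Suc.prems(2) this has_vector_derivative_glue] show ?case
    using Suc.prems by simp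
qed simp

lemma abs_continuous_on_glue:
  assumes "poly L a = poly R a"
  shows "abs_continuous_on 0 1 (glue a L R)"
proof -
  obtain C D where CD: "C-lipschitz_on {0..a} (poly L)" "D-lipschitz_on {a..1} (poly R)"
    using lipschitz_on_poly by metis
  show ?thesis unfolding glue_def[abs_def]
    by (rule lipschitz_imp_abs_continuous_on[OF lipschitz_on_concat_max[OF CD assms]])
qed

lemma glue_bounded: "\<exists>B. \<forall>x\<in>{0..1}. \<bar>glue a L R x\<bar> \<le> B"
proof -
  have "\<exists>B. \<forall>x\<in>{0..1}. \<bar>poly p x\<bar> \<le> B" for p :: "real poly"
    using compact_imp_bounded[OF compact_continuous_image
        [OF abs_continuous_on_imp_continuous_on[OF abs_continuous_on_poly] compact_Icc]]
    by (auto simp: bounded_iff)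
  then obtain B1 B2 where "\<forall>x\<in>{0..1}. \<bar>poly L x\<bar> \<le> B1" "\<forall>x\<in>{0..1}. \<bar>poly R x\<bar> \<le> B2" by meson
  hence "\<forall>x\<in>{0..1}. \<bar>glue a L R x\<bar> \<le> max B1 B2" by (auto simp: glue_def le_max_iff_disj)
  thus ?thesis ..
qed

lemma borel_measurable_glue: "glue a L R \<in> borel_measurable (lebesgue_on S)"
proof -
  have "poly p \<in> borel_measurable borel" for p :: "real poly"
    by (intro borel_measurable_continuous_onI continuous_on_poly continuous_on_id)
  hence "glue a L R \<in> borel_measurable borel"
    unfolding glue_def[abs_def] by measurable
  thus ?thesis by (intro measurable_restrict_space1 measurable_completion) simp
qed

lemma glue_in_W0:
  assumes n: "n > 0" and a: "0 < a" "a < 1"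
    and L: "\<And>j. j < n \<Longrightarrow> poly ((pderiv ^^ j) L) 0 = 0"
    and R: "\<And>j. j < n \<Longrightarrow> poly ((pderiv ^^ j) R) 1 = 0"
    and match: "\<And>j. j < n \<Longrightarrow> poly ((pderiv ^^ j) L) a = poly ((pderiv ^^ j) R) a"
  shows "glue a L R \<in> W0 n"
proof -
  let ?h = "glue a L R" and ?g = "\<lambda>j. glue a ((pderiv ^^ j) L) ((pderiv ^^ j) R)"
  have d: "deriv01 j ?h x = ?g j x" if "j < n" "x \<in> {0..1}" for j x
    using that match by (intro deriv01_glue) auto
  have dn: "deriv01 n ?h x = ?g n x" if "x \<in> {0..1} - {a}" for x
    using that match by (intro deriv01_glue) auto
  have der: "(deriv01 j ?h has_vector_derivative ?g (Suc j) x) (at x within {0..1})"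
    if "j < n" "x \<in> {0..1}" "Suc j < n \<or> x \<noteq> a" for j x
    using that d match[of j] match[of "Suc j"]
    by (intro deriv01_SucI(2)[where g = "?g j"]) (auto intro!: has_vector_derivative_glue[of "(pderiv ^^ j) L", simplified])
  have meas: "deriv01 n ?h \<in> borel_measurable (lebesgue_on {0..1})"
  proof -
    \<comment> \<open>The pieces match only below order \<open>n\<close>, so
      \<open>deriv01 n ?h a\<close> may be an arbitrary default value; it is carried along as a
      constant at one point, here and in the bound \<open>C\<close> below.\<close>
    have "(\<lambda>x. if x = a then deriv01 n ?h a else ?g n x) \<in> borel_measurable (lebesgue_on {0..1})"
      by (intro measurable_If borel_measurable_glue borel_measurable_const) 
         (use a in \<open>auto simp: sets_restrict_space_iff space_restrict_space conj_commute\<close>)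
    also have "?this \<longleftrightarrow> ?thesis"
      by (intro measurable_cong) (use dn in auto)
    finally show ?thesis .
  qed
  have "integrable (lebesgue_on {0..1}) (\<lambda>x. \<bar>deriv01 n ?h x\<bar>\<^sup>2)"
  proof -
    obtain B where B: "\<And>x. x \<in> {0..1} \<Longrightarrow> \<bar>?g n x\<bar> \<le> B"
      using glue_bounded by meson
    define C where "C = max B \<bar>deriv01 n ?h a\<bar>"
    have C: "\<bar>deriv01 n ?h x\<bar> \<le> C" if "x \<in> {0..1}" for x
      using dn[of x] B[of x] that by (cases "x = a") (auto simp: C_def)
    interpret finite_measure "lebesgue_on {0..1::real}" by (rule finite_measure_lebesgue_on) auto
    show ?thesis
    proof (rule integrable_const_bound[where B = "C\<^sup>2"])
      show "AE x in lebesgue_on {0..1}. norm (\<bar>deriv01 n ?h x\<bar>\<^sup>2) \<le> C\<^sup>2"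
      proof (intro AE_I2)
        fix x assume "x \<in> space (lebesgue_on {0..1::real})"
        thus "norm (\<bar>deriv01 n ?h x\<bar>\<^sup>2) \<le> C\<^sup>2" using power_mono[OF C[of x], of 2] by simp
      qed
    qed (use meas in measurable)
  qed
  moreover have "AE x in lebesgue_on {0..1}. deriv01 (n - 1) ?h differentiable (at x within {0..1})"
  proof -
    have "AE x in lebesgue. x \<noteq> a"
      by (rule AE_I'[of "{a}"]) auto
    hence "AE x in lebesgue. x \<in> {0..1} \<longrightarrow> deriv01 (n - 1) ?h differentiable (at x within {0..1})"
      by (rule AE_mp) (use der[of "n - 1"] n in \<open>auto intro!: AE_I2 differentiableI_vector\<close>)
    thus ?thesis by (subst AE_restrict_space_iff) auto
  qed
  moreover have "deriv01 j ?h differentiable_on {0..1}" if "Suc j < n" for j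
    using der[of j] that unfolding differentiable_on_def by (meson Suc_lessD differentiableI_vector)
  moreover have "abs_continuous_on 0 1 (deriv01 j ?h)" if "j < n" for j
    by (rule abs_continuous_on_dominated[OF abs_continuous_on_glue[OF match[OF that]] abs_continuous_on_const zero_less_one])
       (use d[OF that] in auto)
  moreover have "deriv01 j ?h 0 = 0 \<and> deriv01 j ?h 1 = 0" if "j < n" for j
    using d[OF that] a L[OF that] R[OF that] by (auto simp: glue_def)
  ultimately show ?thesis using meas unfolding W0_def by blast
qed

lemma integrable_W0_mult:
  assumes "f \<in> W0 n" "g \<in> W0 n"
  shows "integrable (lebesgue_on {0..1}) (\<lambda>x. deriv01 n f x * deriv01 n g x)"
proof (rule Bochner_Integration.integrable_bound)
  show "integrable (lebesgue_on {0..1}) (\<lambda>x. \<bar>deriv01 n f x\<bar>\<^sup>2 + \<bar>deriv01 n g x\<bar>\<^sup>2)"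
    using assms by (intro Bochner_Integration.integrable_add) (simp_all add: W0_def)
  have [measurable]: "deriv01 n f \<in> borel_measurable (lebesgue_on {0..1})"
    "deriv01 n g \<in> borel_measurable (lebesgue_on {0..1})" using assms by (auto simp: W0_def)
  show "(\<lambda>x. deriv01 n f x * deriv01 n g x) \<in> borel_measurable (lebesgue_on {0..1})"
    by measurable
  have "\<bar>u * v\<bar> \<le> \<bar>u\<^sup>2 + v\<^sup>2\<bar>" for u v :: real
  proof -
    have "2 * \<bar>u * v\<bar> \<le> u\<^sup>2 + v\<^sup>2"
      using sum_squares_bound[of "\<bar>u\<bar>" "\<bar>v\<bar>"] by (simp add: abs_mult)
    thus ?thesis by auto
  qed
  thus "AE x in lebesgue_on {0..1}. norm (deriv01 n f x * deriv01 n g x)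
      \<le> norm (\<bar>deriv01 n f x\<bar>\<^sup>2 + \<bar>deriv01 n g x\<bar>\<^sup>2)"
    by simp
qed

text \<open>The representer of \<open>f \<mapsto> f\<^sup>(\<^sup>k\<^sup>)(a)\<close> with respect to the inner product of the derivatives of order \<open>n\<close>
  is a piecewise polynomial spline with a single jump, in the derivative of order \<open>2n - 1 - k\<close>.\<close>

locale spline =
  fixes n k :: nat and a :: real and L R :: "real poly"
  assumes k: "k < n" and a: "0 < a" "a < 1"
    and L0: "\<And>j. j < n \<Longrightarrow> poly ((pderiv ^^ j) L) 0 = 0"
    and R1: "\<And>j. j < n \<Longrightarrow> poly ((pderiv ^^ j) R) 1 = 0"
    and deg: "(pderiv ^^ (2 * n)) L = 0" "(pderiv ^^ (2 * n)) R = 0"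
    and jump: "\<And>j. j < 2 * n \<Longrightarrow> poly ((pderiv ^^ j) L) a - poly ((pderiv ^^ j) R) a =
      (if j = 2 * n - Suc k then (-1) ^ (n - Suc k) else 0)"
begin

text \<open>The jump sits in order \<open>2 * n - Suc k\<close>, which is at least \<open>n\<close>
  because \<open>k < n\<close>.\<close>

lemma match: "j < n \<Longrightarrow> poly ((pderiv ^^ j) L) a = poly ((pderiv ^^ j) R) a"
proof -
  assume "j < n"
  moreover from this k have "j \<noteq> 2 * n - Suc k" by linarith
  ultimately show ?thesis using jump[of j] by simp
qed

text \<open>The factor \<open>c\<close> allows both uses of the spline: \<open>c = 1\<close> is the
  representer, and a normalising \<open>c\<close> gives the extremal function.\<close>

lemma in_W0: "glue a (smult c L) (smult c R) \<in> W0 n"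
  using k a L0 R1 match by (intro glue_in_W0) (auto simp: higher_pderiv_smult)

lemma deriv01_n:
  assumes "x \<in> {0..1} - {a}"
  shows "deriv01 n (glue a (smult c L) (smult c R)) x =
    c * (if x \<le> a then poly ((pderiv ^^ n) L) x else poly ((pderiv ^^ n) R) x)"
  using assms match by (subst deriv01_glue) (auto simp: higher_pderiv_smult glue_def)

lemma deriv01_k: "deriv01 k (glue a (smult c L) (smult c R)) a = c * poly ((pderiv ^^ k) L) a"
  using k a match by (subst deriv01_glue) (auto simp: higher_pderiv_smult glue_def)

text \<open>Integration by parts on both sides of \<open>a\<close>: the boundary terms at 0 and 1
  vanish with \<open>f\<close>, and at \<open>a\<close> only the index \<open>j = n - Suc k\<close>
  meets the jump. Its sign there cancels the sign chosen for the jump in the locale.\<close>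

lemma represents:
  assumes f: "f \<in> W0 n"
  shows "(LINT x|lebesgue_on {0..1}. deriv01 n f x * deriv01 n (glue a (smult c L) (smult c R)) x)
    = c * deriv01 k f a"
proof -
  let ?h = "glue a (smult c L) (smult c R)"
  define \<Phi> where "\<Phi> q x = (\<Sum>j<n. (-1) ^ j * deriv01 (n - Suc j) f x * poly ((pderiv ^^ j) q) x)" for q x
  define l r where "l = (pderiv ^^ n) (smult c L)" and "r = (pderiv ^^ n) (smult c R)"
  have lr0: "(pderiv ^^ n) l = 0" "(pderiv ^^ n) r = 0"
    using deg by (simp_all add: l_def r_def higher_pderiv_smult funpow_add[symmetric, THEN fun_cong, unfolded o_def] mult_2[symmetric])
  have zero: "\<Phi> q 0 = 0" "\<Phi> q 1 = 0" for q
    using f by (auto simp: \<Phi>_def W0_def intro!: sum.neutral)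
  have n: "n > 0" using k by simp
  have hl: "((\<lambda>x. deriv01 n f x * deriv01 n ?h x) has_integral \<Phi> l a) {0..a}"
  proof (rule has_integral_spike[OF negligible_sing[of a]])
    show "((\<lambda>x. deriv01 n f x * poly l x) has_integral \<Phi> l a) {0..a}"
      using W0_by_parts[OF f n _ _ _ lr0(1), of 0 a] a zero by (simp add: \<Phi>_def)
  qed (use a deriv01_n in \<open>auto simp: l_def higher_pderiv_smult\<close>)
  have hr: "((\<lambda>x. deriv01 n f x * deriv01 n ?h x) has_integral - \<Phi> r a) {a..1}"
  proof (rule has_integral_spike[OF negligible_sing[of a]])
    show "((\<lambda>x. deriv01 n f x * poly r x) has_integral - \<Phi> r a) {a..1}"
      using W0_by_parts[OF f n _ _ _ lr0(2), of a 1] a zero by (simp add: \<Phi>_def)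
  qed (use a deriv01_n in \<open>auto simp: r_def higher_pderiv_smult\<close>)
  have "\<Phi> l a - \<Phi> r a = (\<Sum>j<n. (-1) ^ j * deriv01 (n - Suc j) f a *
      (c * (poly ((pderiv ^^ (j + n)) L) a - poly ((pderiv ^^ (j + n)) R) a)))"
    unfolding \<Phi>_def l_def r_def sum_subtractf[symmetric]
    by (intro sum.cong) (simp_all add: higher_pderiv_smult funpow_add algebra_simps)
  also have "\<dots> = (\<Sum>j<n. if j = n - Suc k then c * deriv01 k f a else 0)"
    using k by (intro sum.cong) (auto simp: jump power_add[symmetric] mult_2[symmetric] algebra_simps)
  also have "\<dots> = c * deriv01 k f a" using k by simp
  finally have "((\<lambda>x. deriv01 n f x * deriv01 n ?h x) has_integral c * deriv01 k f a) {0..1}"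
    using has_integral_combine[OF _ _ hl hr] a by simp
  moreover have "((\<lambda>x. deriv01 n f x * deriv01 n ?h x) has_integral
      (LINT x|lebesgue_on {0..1}. deriv01 n f x * deriv01 n ?h x)) {0..1}"
    by (intro has_integral_integral_lebesgue_on integrable_W0_mult f in_W0) auto
  ultimately show ?thesis using has_integral_unique by blast
qed

theorem A_square: "(A n k a)\<^sup>2 = poly ((pderiv ^^ k) L) a"
proof -
  define h where "h c = glue a (smult c L) (smult c R)" for c
  define N where "N = poly ((pderiv ^^ k) L) a"
  note h = in_W0[folded h_def] and rep = represents[folded h_def]
  \<comment> \<open>The representation property applied to the spline itself: its squared norm is
    its own derivative of order \<open>k\<close> at \<open>a\<close>.\<close>
  have sq: "(LINT x|lebesgue_on {0..1}. \<bar>deriv01 n (h c) x\<bar>\<^sup>2) = c\<^sup>2 * N" for c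
    using rep[OF h, of c c] deriv01_k[of c] by (simp add: power2_eq_square N_def h_def)
  have "0 \<le> (LINT x|lebesgue_on {0..1}. \<bar>deriv01 n (h 1) x\<bar>\<^sup>2)"
    by (intro Bochner_Integration.integral_nonneg) auto
  hence N: "N \<ge> 0" unfolding sq by simp
  have upper: "\<bar>deriv01 k f a\<bar> \<le> sqrt N"
    if f: "f \<in> W0 n" and le: "(LINT x|lebesgue_on {0..1}. \<bar>deriv01 n f x\<bar>\<^sup>2) \<le> 1" for f
  proof -
    define c where "c = deriv01 k f a"
    let ?u = "deriv01 n f" and ?v = "deriv01 n (h 1)" and ?M = "lebesgue_on {0..1}"
    have int: "integrable ?M (\<lambda>x. ?u x * ?u x)" "integrable ?M (\<lambda>x. ?u x * ?v x)"
      "integrable ?M (\<lambda>x. ?v x * ?v x)"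
      by (intro integrable_W0_mult f h)+
    \<comment> \<open>Cauchy-Schwarz by expanding a square. With \<open>c\<close> the value of the
      functional at \<open>f\<close>, the expansion is at most \<open>N - c^2\<close>, with no
      division by a norm.\<close>
    have "0 \<le> (LINT x|?M. (?v x - c * ?u x)\<^sup>2)"
      by (intro Bochner_Integration.integral_nonneg) auto
    also have "(\<lambda>x. (?v x - c * ?u x)\<^sup>2) = (\<lambda>x. ?v x * ?v x - 2 * c * (?u x * ?v x) + c\<^sup>2 * (?u x * ?u x))"
      by (auto simp: power2_eq_square algebra_simps)
    also have "(LINT x|?M. \<dots> x) = (LINT x|?M. ?v x * ?v x) - 2 * c * (LINT x|?M. ?u x * ?v x)
        + c\<^sup>2 * (LINT x|?M. ?u x * ?u x)"
      using int by simp
    also have "\<dots> = N - 2 * c\<^sup>2 + c\<^sup>2 * (LINT x|?M. \<bar>?u x\<bar>\<^sup>2)"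
      using sq[of 1] rep[OF f, of 1] by (simp add: c_def power2_eq_square)
    also have "\<dots> \<le> N - 2 * c\<^sup>2 + c\<^sup>2 * 1"
      by (intro add_left_mono mult_left_mono le) auto
    finally have "c\<^sup>2 \<le> N" by simp
    thus ?thesis unfolding c_def[symmetric] by (rule real_le_rsqrt[of "\<bar>c\<bar>", simplified])
  qed
  have "A n k a = sqrt N"
    unfolding A_def
  proof (rule cSup_eq_maximum)
    \<comment> \<open>This scales the representer to norm 1. For \<open>N = 0\<close> the convention
      \<open>inverse 0 = 0\<close> makes it the zero function, which then attains the supremum
      0.\<close>
    define c where "c = inverse (sqrt N)"
    have "c\<^sup>2 * N \<le> 1" "\<bar>c * N\<bar> = sqrt N"
      using N by (auto simp: c_def power_inverse field_simps real_div_sqrt)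
    thus "sqrt N \<in> {\<bar>deriv01 k f a\<bar> |f. f \<in> W0 n \<and>
        (LINT x|lebesgue_on {0..1}. \<bar>deriv01 n f x\<bar>\<^sup>2) \<le> 1}"
      using h[of c] sq[of c] deriv01_k[of c]
      by (intro CollectI exI[of _ "h c"]) (simp add: h_def N_def)
  qed (use upper in auto)
  thus ?thesis using N by (simp add: N_def)
qed

end

section \<open>The reproducing kernel\<close>

lemma higher_pderiv_diff: "(pderiv ^^ n) (p - q) = (pderiv ^^ n) p - (pderiv ^^ n) (q :: 'a::idom poly)"
  by (induction n arbitrary: p q) (simp_all del: funpow.simps add: funpow_Suc_right pderiv_diff)

lemma higher_pderiv_eq_0:
  assumes "degree p < j"
  shows "(pderiv ^^ j) p = 0"
  by (rule poly_eqI) (use assms in \<open>simp add: coeff_higher_pderiv coeff_eq_0\<close>)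

lemma power_dvd_higher_pderiv:
  fixes l :: "'a :: idom poly"
  assumes "l ^ e dvd p"
  shows "l ^ (e - j) dvd (pderiv ^^ j) p"
proof (induction j)
  case (Suc j)
  show ?case
  proof (cases "e - j")
    case 0
    thus ?thesis by simp
  next
    case (Suc i)
    hence "l ^ Suc i dvd (pderiv ^^ j) p" using Suc.IH by simp
    then obtain q where q: "(pderiv ^^ j) p = l ^ Suc i * q" by (elim dvdE)
    have "(pderiv ^^ Suc j) p = l ^ i * (l * pderiv q + smult (of_nat (Suc i)) (q * pderiv l))"
      by (simp add: q pderiv_mult pderiv_power_Suc algebra_simps del: power_Suc of_nat_Suc)
         (simp add: algebra_simps)
    moreover have "e - Suc j = i" using Suc by simp
    ultimately show ?thesis by (metis dvd_triv_left)
  qed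
qed (use assms in simp)

lemma higher_pderiv_root:
  fixes l :: "'a :: idom poly"
  assumes "l ^ e dvd p" "j < e" "poly l c = 0"
  shows "poly ((pderiv ^^ j) p) c = 0"
proof -
  obtain q where "(pderiv ^^ j) p = l ^ (e - j) * q"
    using power_dvd_higher_pderiv[OF assms(1), of j] by (elim dvdE)
  thus ?thesis using assms by simp
qed

text \<open>Dividing by \<open>fact e\<close> keeps falling factorials away. The cases
  \<open>d = 1\<close> and \<open>d = -1\<close> differentiate a power of x - y in x and in
  y.\<close>

lemma higher_pderiv_linear_power:
  fixes c d :: real
  shows "(pderiv ^^ j) (smult (1 / fact e) ([:c, d:] ^ e)) =
    (if j \<le> e then smult (d ^ j / fact (e - j)) ([:c, d:] ^ (e - j)) else 0)"
proof (induction j)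
  case (Suc j)
  show ?case
  proof (cases "j < e")
    case True
    then obtain i where i: "e - j = Suc i" "e - Suc j = i" by (metis Suc_diff_Suc)
    have "(pderiv ^^ Suc j) (smult (1 / fact e) ([:c, d:] ^ e))
        = pderiv (smult (d ^ j / fact (Suc i)) ([:c, d:] ^ Suc i))"
      using Suc.IH True i by simp
    also have "\<dots> = smult (d ^ Suc j / fact i) ([:c, d:] ^ i)"
      by (simp add: pderiv_smult pderiv_power_Suc pderiv_pCons del: power_Suc of_nat_Suc)
         (simp add: divide_simps mult.commute)
    finally show ?thesis using True i by simp
  qed (use Suc.IH in \<open>auto simp: pderiv_smult\<close>)
qed simp

text \<open>With \<open>p = x (1 - y)\<close>, \<open>q = y (1 - x)\<close> and \<open>n = m + 1\<close>, the reproducing kernel is, up to sign, for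
  \<open>x \<le> y\<close> the upper half \<open>i \<ge> n\<close> of the binomial expansion of
  \<open>(x - y)\<^sup>2\<^sup>n\<^sup>-\<^sup>1 = (p - q)\<^sup>2\<^sup>n\<^sup>-\<^sup>1\<close>, divided by \<open>(2n - 1)!\<close>. Its term of index \<open>i = n + r\<close> is \<open>kcoeff m r\<close> times
  \<open>poly (kleft m r) x * poly (kright m r) y\<close>.\<close>

definition kcoeff :: "nat \<Rightarrow> nat \<Rightarrow> real"
  where "kcoeff m r = (-1) ^ r * real (2 * m + 1 choose (m + 1 + r)) / fact (2 * m + 1)"

definition kleft :: "nat \<Rightarrow> nat \<Rightarrow> real poly"
  where "kleft m r = [:0, 1:] ^ (m + 1 + r) * [:1, -1:] ^ (m - r)"

definition kright :: "nat \<Rightarrow> nat \<Rightarrow> real poly"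
  where "kright m r = [:1, -1:] ^ (m + 1 + r) * [:0, 1:] ^ (m - r)"

lemma poly_kleft: "poly (kleft m r) x = x ^ (m + 1 + r) * (1 - x) ^ (m - r)"
  and poly_kright: "poly (kright m r) x = (1 - x) ^ (m + 1 + r) * x ^ (m - r)"
  by (simp_all add: kleft_def kright_def algebra_simps)

text \<open>Exchanging x and y exchanges \<open>p\<close> and \<open>q\<close> and so turns the
  upper half of the expansion into the lower half, up to sign; the difference of the two branches of
  the kernel is therefore the full binomial power. It provides the jump conditions of the
  spline.\<close>

lemma kernel_difference:
  "(\<Sum>r\<le>m. kcoeff m r * (poly (kleft m r) x * poly (kright m r) y - poly (kleft m r) y * poly (kright m r) x))
    = (-1) ^ m * (x - y) ^ (2 * m + 1) / fact (2 * m + 1)"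
proof -
  define N where "N = 2 * m + 1"
  define p q where "p = x * (1 - y)" and "q = y * (1 - x)"
  define b where "b i = real (N choose i) * p ^ i * (- q) ^ (N - i)" for i
  have "(x - y) ^ N = (p + (- q)) ^ N" by (simp add: p_def q_def algebra_simps)
  also have "\<dots> = (\<Sum>i\<le>N. b i)" unfolding b_def by (rule binomial_ring)
  also have "{..N} = {m + 1..N} \<union> {..m}" by (auto simp: N_def)
  also have "sum b \<dots> = sum b {m + 1..N} + sum b {..m}" by (rule sum.union_disjoint) auto
  also have "sum b {m + 1..N} = (\<Sum>r\<le>m. b (m + 1 + r))"
    by (rule sum.reindex_bij_witness[of _ "\<lambda>r. m + 1 + r" "\<lambda>i. i - (m + 1)"]) (auto simp: N_def)
  \<comment> \<open>The reversed index pairs \<open>m - r\<close> with \<open>m + 1 + r\<close>;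
    they add up to \<open>N\<close>, so the binomial coefficients agree.\<close>
  also have "sum b {..m} = (\<Sum>r\<le>m. b (m - r))"
    by (rule sum.reindex_bij_witness[of _ "\<lambda>r. m - r" "\<lambda>i. m - i"]) auto
  finally have "(-1) ^ m * (x - y) ^ N / fact N = (\<Sum>r\<le>m. (-1) ^ m * (b (m + 1 + r) + b (m - r)) / fact N)"
    by (simp only: sum.distrib[symmetric] sum_distrib_left sum_divide_distrib)
  also have "\<dots> = (\<Sum>r\<le>m. kcoeff m r *
      (poly (kleft m r) x * poly (kright m r) y - poly (kleft m r) y * poly (kright m r) x))"
  proof (rule sum.cong)
    fix r assume "r \<in> {..m}"
    hence r: "r \<le> m" by simp
    have e: "N - (m + 1 + r) = m - r" "N - (m - r) = m + 1 + r" using r by (auto simp: N_def)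
    have c: "N choose (m - r) = N choose (m + 1 + r)"
      using binomial_symmetric[of "m - r" N] r e by (simp add: N_def)
    have s: "(-1) ^ m * (-1) ^ (m - r) = (-1 :: real) ^ r"
      using r by (simp add: minus_one_power_iff)
    have s': "(-1) ^ m * (-1) ^ (m + 1 + r) = - ((-1 :: real) ^ r)"
      by (simp add: minus_one_power_iff)
    have 1: "(-1) ^ m * b (m + 1 + r) = (-1) ^ r * real (N choose (m + 1 + r)) * (p ^ (m + 1 + r) * q ^ (m - r))"
      unfolding b_def e s[symmetric] power_minus[of q] by (simp only: mult_ac)
    have 2: "(-1) ^ m * b (m - r) = - ((-1) ^ r * real (N choose (m + 1 + r)) * (p ^ (m - r) * q ^ (m + 1 + r)))"
    proof -
      have "(-1) ^ m * b (m - r) = ((-1) ^ m * (-1) ^ (m + 1 + r)) * real (N choose (m + 1 + r)) * (p ^ (m - r) * q ^ (m + 1 + r))"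
        unfolding b_def e c power_minus[of q] by (simp only: mult_ac)
      thus ?thesis unfolding s' by simp
    qed
    have 3: "poly (kleft m r) x * poly (kright m r) y = p ^ (m + 1 + r) * q ^ (m - r)"
      "poly (kleft m r) y * poly (kright m r) x = p ^ (m - r) * q ^ (m + 1 + r)"
      unfolding poly_kleft poly_kright p_def q_def power_mult_distrib by (simp_all only: mult_ac)
    show "(-1) ^ m * (b (m + 1 + r) + b (m - r)) / fact N = kcoeff m r *
      (poly (kleft m r) x * poly (kright m r) y - poly (kleft m r) y * poly (kright m r) x)"
      unfolding 3 distrib_left 1 2 kcoeff_def N_def[symmetric]
      by (simp add: diff_divide_distrib right_diff_distrib mult_ac)
  qed simp
  finally show ?thesis by (simp add: N_def)
qed

text \<open>The derivative of the kernel in the direction \<open>(1, 1)\<close>: as \<open>p\<close> and \<open>q\<close> have the same derivative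
  \<open>1 - x - y\<close>, the sum telescopes.\<close>

lemma kernel_diagonal_derivative:
  "(\<Sum>r\<le>m. kcoeff m r * (poly (pderiv (kleft m r)) x * poly (kright m r) y
        + poly (kleft m r) x * poly (pderiv (kright m r)) y))
    = (1 - x - y) * (x * (1 - x)) ^ m * (y * (1 - y)) ^ m / (fact m)\<^sup>2"
proof -
  define p q where "p = x * (1 - y)" and "q = y * (1 - x)"
  \<comment> \<open>The absorption identities turn the coefficients of row \<open>2 * m + 1\<close>
    into row \<open>2 * m\<close>: differentiating \<open>p\<close> produces \<open>G r\<close>,
    differentiating \<open>q\<close> produces \<open>- G (Suc r)\<close>.\<close>
  define G where "G r = (-1) ^ r * real (2 * m choose (m + r)) * p ^ (m + r) * q ^ (m - r) / fact (2 * m)" for r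
  have "kcoeff m r * (poly (pderiv (kleft m r)) x * poly (kright m r) y
        + poly (kleft m r) x * poly (pderiv (kright m r)) y) = (1 - x - y) * (G r - G (Suc r))"
    if r: "r \<le> m" for r
  proof -
    have l: "poly (pderiv (kleft m r)) x =
      (m + 1 + r) * x ^ (m + r) * (1 - x) ^ (m - r) - (m - r) * x ^ (m + 1 + r) * (1 - x) ^ (m - r - 1)"
      by (simp add: kleft_def pderiv_mult pderiv_power pderiv_pCons del: power_Suc of_nat_Suc of_nat_add of_nat_diff)
    have rr: "poly (pderiv (kright m r)) y =
      (m - r) * y ^ (m - r - 1) * (1 - y) ^ (m + 1 + r) - (m + 1 + r) * y ^ (m - r) * (1 - y) ^ (m + r)"
      by (simp add: kright_def pderiv_mult pderiv_power pderiv_pCons del: power_Suc of_nat_Suc of_nat_add of_nat_diff)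
    \<comment> \<open>For \<open>r = m\<close> the truncated exponent \<open>m - r - 1\<close> is 0
      and lowering the power would be wrong; the factor \<open>real (m - r)\<close> vanishes exactly
      then.\<close>
    have red: "real (m - r) * z ^ (m - r) = real (m - r) * (z * z ^ (m - r - 1))" for z :: real
      by (cases "m - r") auto
    have "poly (pderiv (kleft m r)) x * poly (kright m r) y + poly (kleft m r) x * poly (pderiv (kright m r)) y
      = (1 - x - y) * (real (m + 1 + r) * p ^ (m + r) * q ^ (m - r)
          + real (m - r) * p ^ (m + 1 + r) * q ^ (m - r - 1))"
    proof -
      have ring: "(c1 * X * u - c2 * (x * X) * u1) * ((1 - y) * Y * w) + (x * X * u) * (c2 * w1 * ((1 - y) * Y) - c1 * w * Y)
          = (1 - x - y) * (c1 * (X * Y) * (w * u) + c2 * (x * (1 - y) * (X * Y)) * (w1 * u1))"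
        if "c2 * w = c2 * (y * w1)" "c2 * u = c2 * ((1 - x) * u1)" for c1 c2 X Y u w u1 w1 :: real
        using that by algebra
      have pq: "p ^ (m + r) = x ^ (m + r) * (1 - y) ^ (m + r)" "q ^ (m - r) = y ^ (m - r) * (1 - x) ^ (m - r)"
        "p ^ (m + 1 + r) = x * (1 - y) * (x ^ (m + r) * (1 - y) ^ (m + r))"
        "q ^ (m - r - 1) = y ^ (m - r - 1) * (1 - x) ^ (m - r - 1)"
        by (simp_all add: p_def q_def power_mult_distrib)
      have Suc: "z ^ (m + 1 + r) = z * z ^ (m + r)" for z :: real by simp
      have lv: "poly (kleft m r) x = x * x ^ (m + r) * (1 - x) ^ (m - r)"
        "poly (kright m r) y = (1 - y) * (1 - y) ^ (m + r) * y ^ (m - r)"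
        unfolding poly_kleft poly_kright by simp_all
      show ?thesis unfolding l rr lv pq unfolding Suc
        by (rule ring[OF red red])
    qed
    moreover have "kcoeff m r * (real (m + 1 + r) * p ^ (m + r) * q ^ (m - r)) = G r"
    proof -
      have "real (2 * m + 1 choose (m + 1 + r)) * real (m + 1 + r) = real (2 * m + 1) * real (2 * m choose (m + r))"
        using Suc_times_binomial_eq[of "2 * m" "m + r"] by (metis Suc_eq_plus1 add.commute add.left_commute of_nat_mult)
      hence "kcoeff m r * real (m + 1 + r) = (-1) ^ r * (real (2 * m + 1) * real (2 * m choose (m + r))) / fact (2 * m + 1)"
        by (metis kcoeff_def mult.assoc times_divide_eq_left)
      also have "\<dots> = (-1) ^ r * real (2 * m choose (m + r)) / fact (2 * m)"
        by (simp add: divide_simps)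
      finally show ?thesis unfolding G_def mult.assoc[symmetric] by (simp add: mult_ac)
    qed
    moreover have "kcoeff m r * (real (m - r) * p ^ (m + 1 + r) * q ^ (m - r - 1)) = - G (Suc r)"
    proof -
      have "real (2 * m + 1 choose (m + 1 + r)) * real (m - r) = real (2 * m + 1) * real (2 * m choose (m + 1 + r))"
      proof -
        have "(m - r) * (2 * m + 1 choose (m + 1 + r)) = (2 * m + 1) * (2 * m choose (m + 1 + r))"
          using binomial_absorb_comp[of "2 * m + 1" "m + 1 + r"] r by simp
        thus ?thesis by (metis mult.commute of_nat_mult)
      qed
      hence "kcoeff m r * real (m - r) = (-1) ^ r * (real (2 * m + 1) * real (2 * m choose (m + 1 + r))) / fact (2 * m + 1)"
        by (metis kcoeff_def mult.assoc times_divide_eq_left)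
      also have "\<dots> = (-1) ^ r * real (2 * m choose (m + 1 + r)) / fact (2 * m)"
        by (simp add: divide_simps)
      finally show ?thesis unfolding G_def mult.assoc[symmetric] by (simp add: mult_ac)
    qed
    moreover have "\<kappa> * S = w * (g - h)" if "S = w * (P + Q)" "\<kappa> * P = g" "\<kappa> * Q = - h"
      for S w P Q \<kappa> g h :: real
      using that by algebra
    ultimately show ?thesis by blast
  qed
  hence "(\<Sum>r\<le>m. kcoeff m r * (poly (pderiv (kleft m r)) x * poly (kright m r) y
        + poly (kleft m r) x * poly (pderiv (kright m r)) y)) = (\<Sum>r\<le>m. (1 - x - y) * (G r - G (Suc r)))"
    by (intro sum.cong) auto
  also have "\<dots> = (1 - x - y) * (\<Sum>r\<le>m. G r - G (Suc r))" by (simp add: sum_distrib_left)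
  also have "(\<Sum>r\<le>m. G r - G (Suc r)) = G 0 - G (Suc m)" by (rule sum_telescope)
  \<comment> \<open>\<open>G (Suc m)\<close> contains \<open>2 * m choose (2 * m + 1)\<close>, which
    is 0; in \<open>G 0\<close> the central binomial coefficient over \<open>fact (2 * m)\<close> is
    the inverse square of \<open>fact m\<close>.\<close>
  also have "\<dots> = (p * q) ^ m / (fact m)\<^sup>2"
    using binomial_fact[of m "2 * m", where 'a = real]
    by (simp add: G_def power_mult_distrib power2_eq_square mult_2 binomial_eq_0 field_simps)
  finally show ?thesis by (simp add: p_def q_def power_mult_distrib mult_ac)
qed

section \<open>Mixed derivatives of the kernel on the diagonal\<close>

definition kdiag :: "nat \<Rightarrow> nat \<Rightarrow> real \<Rightarrow> real"
  where "kdiag m k a = (\<Sum>r\<le>m. kcoeff m r * poly ((pderiv ^^ k) (kright m r)) a * poly ((pderiv ^^ k) (kleft m r)) a)"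

lemma degree_kernel: "degree (kleft m r) < 2 * Suc m" "degree (kright m r) < 2 * Suc m" if "r \<le> m"
proof -
  have *: "degree (p ^ (m + 1 + r) * q ^ (m - r)) < 2 * Suc m" if "degree p \<le> 1" "degree q \<le> 1" for p q :: "real poly"
  proof -
    have "degree (p ^ (m + 1 + r) * q ^ (m - r)) \<le> degree p * (m + 1 + r) + degree q * (m - r)"
      by (intro order.trans[OF degree_mult_le] add_mono degree_power_le)
    also have "\<dots> \<le> 1 * (m + 1 + r) + 1 * (m - r)" by (intro add_mono mult_right_mono that) auto
    finally show ?thesis using \<open>r \<le> m\<close> by simp
  qed
  show "degree (kleft m r) < 2 * Suc m" "degree (kright m r) < 2 * Suc m"
    unfolding kleft_def kright_def by (rule *; simp)+
qed

lemma kernel_roots: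
  assumes "j < Suc m"
  shows "poly ((pderiv ^^ j) (kleft m r)) 0 = 0" "poly ((pderiv ^^ j) (kright m r)) 1 = 0"
  unfolding kleft_def kright_def by (rule higher_pderiv_root[OF dvd_triv_left]; use assms in simp)+

text \<open>The pieces are the two branches of d_y^k K(x,y) at y = a, as polynomials in x.
  Differentiating \<open>kernel_difference\<close> j times in x and k times in y leaves a power of x
  - y with exponent \<open>N - j - k\<close>; at x = y = a it survives only for exponent 0, which is
  the prescribed jump.\<close>

lemma spline_kernel:
  assumes "k \<le> m" "0 < a" "a < 1"
  shows "spline (Suc m) k a
    (\<Sum>r\<le>m. smult (kcoeff m r * poly ((pderiv ^^ k) (kright m r)) a) (kleft m r))
    (\<Sum>r\<le>m. smult (kcoeff m r * poly ((pderiv ^^ k) (kleft m r)) a) (kright m r))"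
    (is "spline _ _ _ ?L ?R")
proof
  fix j assume j: "j < Suc m"
  show "poly ((pderiv ^^ j) ?L) 0 = 0" "poly ((pderiv ^^ j) ?R) 1 = 0"
    by (simp_all only: higher_pderiv_sum higher_pderiv_smult poly_sum poly_smult kernel_roots[OF j])
       simp_all
next
  show "(pderiv ^^ (2 * Suc m)) ?L = 0" "(pderiv ^^ (2 * Suc m)) ?R = 0"
    by (simp_all only: higher_pderiv_sum higher_pderiv_smult)
       (auto intro!: sum.neutral simp: higher_pderiv_eq_0[OF degree_kernel(1)] higher_pderiv_eq_0[OF degree_kernel(2)]
          simp del: mult_Suc_right funpow.simps)
next
  fix j assume j: "j < 2 * Suc m"
  define N where "N = 2 * m + 1"
  \<comment> \<open>Here \<open>y\<close> is frozen and the identity is one of polynomials in x; in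
    \<open>step2\<close> the roles are exchanged.\<close>
  have step1: "(\<Sum>r\<le>m. kcoeff m r * (poly ((pderiv ^^ j) (kleft m r)) x * poly (kright m r) y
      - poly (kleft m r) y * poly ((pderiv ^^ j) (kright m r)) x)) = (-1) ^ m * (x - y) ^ (N - j) / fact (N - j)" for x y
  proof -
    have "(\<Sum>r\<le>m. smult (kcoeff m r) (smult (poly (kright m r) y) (kleft m r) - smult (poly (kleft m r) y) (kright m r)))
       = smult ((-1) ^ m) (smult (1 / fact N) ([:- y, 1:] ^ N))"
      by (intro poly_ext)
         (use kernel_difference[of m _ y, folded N_def] in \<open>simp add: poly_sum mult_ac\<close>)
    hence "poly ((pderiv ^^ j) (\<Sum>r\<le>m. smult (kcoeff m r) (smult (poly (kright m r) y) (kleft m r)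
        - smult (poly (kleft m r) y) (kright m r)))) x
       = poly ((pderiv ^^ j) (smult ((-1) ^ m) (smult (1 / fact N) ([:- y, 1:] ^ N)))) x" by (rule arg_cong)
    also have "\<dots> = (-1) ^ m * (x - y) ^ (N - j) / fact (N - j)"
      unfolding higher_pderiv_smult[of _ "(-1) ^ m"] higher_pderiv_linear_power using j by (simp add: N_def)
    finally show ?thesis
      by (simp only: higher_pderiv_sum higher_pderiv_smult higher_pderiv_diff poly_sum poly_smult poly_diff mult.commute)
  qed
  have step2: "(\<Sum>r\<le>m. kcoeff m r * (poly ((pderiv ^^ j) (kleft m r)) x * poly ((pderiv ^^ k) (kright m r)) y
      - poly ((pderiv ^^ k) (kleft m r)) y * poly ((pderiv ^^ j) (kright m r)) x))
      = (if k \<le> N - j then (-1) ^ m * (-1) ^ k * (x - y) ^ (N - j - k) / fact (N - j - k) else 0)" for x y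
  proof -
    have "(\<Sum>r\<le>m. smult (kcoeff m r) (smult (poly ((pderiv ^^ j) (kleft m r)) x) (kright m r)
        - smult (poly ((pderiv ^^ j) (kright m r)) x) (kleft m r)))
       = smult ((-1) ^ m) (smult (1 / fact (N - j)) ([:x, -1:] ^ (N - j)))"
      by (intro poly_ext)
         (use step1[of x] in \<open>simp add: poly_sum mult_ac\<close>)
    hence "poly ((pderiv ^^ k) (\<Sum>r\<le>m. smult (kcoeff m r) (smult (poly ((pderiv ^^ j) (kleft m r)) x) (kright m r)
        - smult (poly ((pderiv ^^ j) (kright m r)) x) (kleft m r)))) y
       = poly ((pderiv ^^ k) (smult ((-1) ^ m) (smult (1 / fact (N - j)) ([:x, -1:] ^ (N - j))))) y" by (rule arg_cong)
    also have "\<dots> = (if k \<le> N - j then (-1) ^ m * (-1) ^ k * (x - y) ^ (N - j - k) / fact (N - j - k) else 0)"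
      unfolding higher_pderiv_smult[of _ "(-1) ^ m"] higher_pderiv_linear_power by simp
    finally show ?thesis
      by (simp only: higher_pderiv_sum higher_pderiv_smult higher_pderiv_diff poly_sum poly_smult poly_diff mult.commute)
  qed
  have "poly ((pderiv ^^ j) ?L) a - poly ((pderiv ^^ j) ?R) a =
    (\<Sum>r\<le>m. kcoeff m r * (poly ((pderiv ^^ j) (kleft m r)) a * poly ((pderiv ^^ k) (kright m r)) a
      - poly ((pderiv ^^ k) (kleft m r)) a * poly ((pderiv ^^ j) (kright m r)) a))"
    by (simp add: higher_pderiv_sum higher_pderiv_smult poly_sum sum_subtractf[symmetric] algebra_simps)
  also have "\<dots> = (if j = 2 * Suc m - Suc k then (-1) ^ (Suc m - Suc k) else 0)"
    unfolding step2 using assms(1) j by (auto simp: N_def minus_one_power_iff power_0_left)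
  finally show "poly ((pderiv ^^ j) ?L) a - poly ((pderiv ^^ j) ?R) a =
    (if j = 2 * Suc m - Suc k then (-1) ^ (Suc m - Suc k) else 0)" .
qed (use assms in auto)

corollary A_square_kernel:
  assumes "k \<le> m" "0 < a" "a < 1"
  shows "(A (Suc m) k a)\<^sup>2 = kdiag m k a"
  using spline.A_square[OF spline_kernel[OF assms]]
  by (simp add: kdiag_def higher_pderiv_sum higher_pderiv_smult poly_sum)

text \<open>As 1 - x - y is half the sum of 1 - 2x and 1 - 2y,
  \<open>kernel_diagonal_derivative\<close> becomes a sum of two products with separated variables,
  and the derivatives in x (\<open>step1\<close>) and in y (\<open>step2\<close>) act on single
  factors. For x = y = a the two products coincide, which cancels the 2 in \<open>c\<close>.\<close>

theorem kdiag_has_field_derivative: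
  fixes a :: real
  defines "T \<equiv> [:0, 1, -1:]"
  shows "(kdiag m k has_field_derivative
    poly ((pderiv ^^ k) (T ^ m)) a * poly ((pderiv ^^ k) ([:1, -2:] * T ^ m)) a / (fact m)\<^sup>2) (at a)"
proof -
  define c where "c = 1 / (2 * (fact m)\<^sup>2 :: real)"
  define U where "U = [:1, -2:] * T ^ m"
  have T: "poly T x = x * (1 - x)" for x by (simp add: T_def algebra_simps)
  have step0: "(\<Sum>r\<le>m. kcoeff m r * (poly (pderiv (kleft m r)) x * poly (kright m r) y
        + poly (kleft m r) x * poly (pderiv (kright m r)) y)) = c * (poly U x * poly (T ^ m) y + poly (T ^ m) x * poly U y)" for x y
    unfolding kernel_diagonal_derivative c_def U_def by (simp add: T field_simps)
  have step1: "(\<Sum>r\<le>m. kcoeff m r * (poly ((pderiv ^^ Suc k) (kleft m r)) x * poly (kright m r) y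
        + poly ((pderiv ^^ k) (kleft m r)) x * poly (pderiv (kright m r)) y))
        = c * (poly ((pderiv ^^ k) U) x * poly (T ^ m) y + poly ((pderiv ^^ k) (T ^ m)) x * poly U y)" for x y
  proof -
    have "(\<Sum>r\<le>m. smult (kcoeff m r) (smult (poly (kright m r) y) (pderiv (kleft m r))
          + smult (poly (pderiv (kright m r)) y) (kleft m r)))
       = smult c (smult (poly (T ^ m) y) U + smult (poly U y) (T ^ m))"
      by (intro poly_ext) (use step0[of _ y] in \<open>simp add: poly_sum mult_ac\<close>)
    hence "poly ((pderiv ^^ k) (\<Sum>r\<le>m. smult (kcoeff m r) (smult (poly (kright m r) y) (pderiv (kleft m r))
          + smult (poly (pderiv (kright m r)) y) (kleft m r)))) x
       = poly ((pderiv ^^ k) (smult c (smult (poly (T ^ m) y) U + smult (poly U y) (T ^ m)))) x" by (rule arg_cong)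
    thus ?thesis
      by (simp only: higher_pderiv_sum higher_pderiv_smult higher_pderiv_add poly_sum funpow_Suc_right o_apply)
         (simp add: algebra_simps)
  qed
  have step2: "(\<Sum>r\<le>m. kcoeff m r * (poly ((pderiv ^^ Suc k) (kleft m r)) x * poly ((pderiv ^^ k) (kright m r)) y
        + poly ((pderiv ^^ k) (kleft m r)) x * poly ((pderiv ^^ Suc k) (kright m r)) y))
        = c * (poly ((pderiv ^^ k) U) x * poly ((pderiv ^^ k) (T ^ m)) y + poly ((pderiv ^^ k) (T ^ m)) x * poly ((pderiv ^^ k) U) y)" for x y
  proof -
    have "(\<Sum>r\<le>m. smult (kcoeff m r) (smult (poly ((pderiv ^^ Suc k) (kleft m r)) x) (kright m r)
          + smult (poly ((pderiv ^^ k) (kleft m r)) x) (pderiv (kright m r))))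
       = smult c (smult (poly ((pderiv ^^ k) U) x) (T ^ m) + smult (poly ((pderiv ^^ k) (T ^ m)) x) U)"
      by (intro poly_ext) (use step1[of x] in \<open>simp add: poly_sum mult_ac\<close>)
    hence "poly ((pderiv ^^ k) (\<Sum>r\<le>m. smult (kcoeff m r) (smult (poly ((pderiv ^^ Suc k) (kleft m r)) x) (kright m r)
          + smult (poly ((pderiv ^^ k) (kleft m r)) x) (pderiv (kright m r))))) y
       = poly ((pderiv ^^ k) (smult c (smult (poly ((pderiv ^^ k) U) x) (T ^ m) + smult (poly ((pderiv ^^ k) (T ^ m)) x) U))) y" by (rule arg_cong)
    thus ?thesis
      by (simp only: higher_pderiv_sum higher_pderiv_smult higher_pderiv_add poly_sum funpow_Suc_right o_apply)
         (simp add: algebra_simps)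
  qed
  have "(kdiag m k has_field_derivative (\<Sum>r\<le>m. kcoeff m r * (poly ((pderiv ^^ Suc k) (kleft m r)) a * poly ((pderiv ^^ k) (kright m r)) a
        + poly ((pderiv ^^ k) (kleft m r)) a * poly ((pderiv ^^ Suc k) (kright m r)) a))) (at a)"
    unfolding kdiag_def[abs_def]
  proof (rule DERIV_sum)
    fix r
    show "((\<lambda>a. kcoeff m r * poly ((pderiv ^^ k) (kright m r)) a * poly ((pderiv ^^ k) (kleft m r)) a) has_field_derivative
       kcoeff m r * (poly ((pderiv ^^ Suc k) (kleft m r)) a * poly ((pderiv ^^ k) (kright m r)) a
        + poly ((pderiv ^^ k) (kleft m r)) a * poly ((pderiv ^^ Suc k) (kright m r)) a)) (at a)"
      by (rule derivative_eq_intros poly_DERIV refl | simp add: algebra_simps)+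
  qed
  thus ?thesis unfolding step2 by (simp add: U_def c_def)
qed

section \<open>The derivative for \<open>k = 3\<close>\<close>

definition parabola :: "real poly" where "parabola = [:0, 1, -1:]"

lemma poly_parabola: "poly parabola x = x * (1 - x)"
  by (simp add: parabola_def algebra_simps)

lemma pderiv_parabola_power: "pderiv (parabola ^ Suc e) = smult (real e + 1) ([:1, -2:] * parabola ^ e)"
proof -
  have "pderiv parabola = [:1, -2:]" by (simp add: parabola_def pderiv_pCons)
  thus ?thesis by (simp only: pderiv_power_Suc of_nat_Suc mult_smult_left mult_smult_right mult.commute add.commute)
qed

text \<open>From (1 - 2x)^2 = 1 - 4x(1-x). With \<open>pderiv_parabola_power\<close> it keeps all
  derivatives within combinations of powers of \<open>parabola\<close>, with or without a factor 1 -
  2x.\<close>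

lemma pderiv_linear_parabola_power:
  "pderiv ([:1, -2:] * parabola ^ Suc e) = smult (real e + 1) (parabola ^ e) - smult (4 * real e + 6) (parabola ^ Suc e)"
proof (rule poly_ext)
  fix x
  have 1: "pderiv ([:1, -2:] * parabola ^ Suc e) = [:1, -2:] * smult (real e + 1) ([:1, -2:] * parabola ^ e) + parabola ^ Suc e * [:-2:]"
    by (subst pderiv_mult, subst pderiv_parabola_power) (simp add: pderiv_pCons)
  show "poly (pderiv ([:1, -2:] * parabola ^ Suc e)) x =
      poly (smult (real e + 1) (parabola ^ e) - smult (4 * real e + 6) (parabola ^ Suc e)) x"
    unfolding 1 by (simp add: poly_parabola algebra_simps)
qed

text \<open>This factor of the derivative contributes the critical points 1/2 and, through its part
  linear in x(1-x), those belonging to \<open>t3\<close>.\<close>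

lemma pderiv3_parabola_power:
  "poly ((pderiv ^^ 3) (parabola ^ (e + 3))) x =
    (real e + 3) * (real e + 2) * (1 - 2 * x) * (x * (1 - x)) ^ e
      * ((real e + 1) - (4 * real e + 10) * (x * (1 - x)))"
proof -
  define z P E where "z = x * (1 - x)" and "P = z ^ e" and "E = real e"
  let ?p = "(pderiv ^^ 3) (parabola ^ (e + 3))"
  have "?p = pderiv (pderiv (pderiv (parabola ^ Suc (Suc (Suc e)))))"
    by (simp add: numeral_3_eq_3)
  also have "\<dots> = smult (real e + 3) (smult (real e + 2) (smult (real e + 1) ([:1, -2:] * parabola ^ e))
      - smult (4 * real e + 10) (smult (real e + 2) ([:1, -2:] * parabola ^ Suc e)))"
    by (simp only: pderiv_parabola_power pderiv_linear_parabola_power pderiv_smult pderiv_diff) (simp add: algebra_simps)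
  finally have eq: "?p = \<dots>" .
  show ?thesis unfolding eq
    by (simp only: poly_smult poly_diff poly_mult poly_power poly_pCons poly_0 poly_parabola power_Suc
        z_def[symmetric] P_def[symmetric] E_def[symmetric]) algebra
qed

text \<open>The part quadratic in x(1-x) contributes the critical points belonging to
  \<open>t1\<close> and \<open>t2\<close>.\<close>

lemma pderiv3_linear_parabola_power:
  "poly ((pderiv ^^ 3) ([:1, -2:] * parabola ^ (e + 3))) x =
    (real e + 3) * (x * (1 - x)) ^ e * ((real e + 2) * (real e + 1)
      - (real e + 2) * (8 * real e + 20) * (x * (1 - x))
      + (4 * real e + 14) * (4 * real e + 10) * (x * (1 - x))\<^sup>2)"
proof -
  define z P E where "z = x * (1 - x)" and "P = z ^ e" and "E = real e"
  let ?p = "(pderiv ^^ 3) ([:1, -2:] * parabola ^ (e + 3))"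
  have "?p = pderiv (pderiv (pderiv ([:1, -2:] * parabola ^ Suc (Suc (Suc e)))))"
    by (simp add: numeral_3_eq_3)
  also have "\<dots> = smult (real e + 3) (smult (real e + 2) (smult (real e + 1) (parabola ^ e) - smult (4 * real e + 6) (parabola ^ Suc e)))
      - smult (4 * real e + 14) (smult (real e + 3) (smult (real e + 2) (parabola ^ Suc e) - smult (4 * real e + 10) (parabola ^ Suc (Suc e))))"
    by (simp only: pderiv_parabola_power pderiv_linear_parabola_power pderiv_smult pderiv_diff) (simp add: algebra_simps)
  finally have eq: "?p = \<dots>" .
  show ?thesis unfolding eq
    by (simp only: poly_smult poly_diff poly_mult poly_power poly_parabola power_Suc
        z_def[symmetric] P_def[symmetric] E_def[symmetric]) algebra
qed

section \<open>Local extrema\<close>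

lemma local_min_on_uminus: "local_min_on S (\<lambda>x. - F x) r \<longleftrightarrow> local_max_on S F r"
  and local_max_on_uminus: "local_max_on S (\<lambda>x. - F x) r \<longleftrightarrow> local_min_on S F r"
  by (simp_all add: local_min_on_def local_max_on_def)

lemma no_local_min_on:
  fixes F :: "real \<Rightarrow> real"
  assumes "open S" "(F has_field_derivative D) (at a)" "D \<noteq> 0"
  shows "\<not> local_min_on S F a"
proof
  assume "local_min_on S F a"
  then obtain d where d: "a \<in> S" "d > 0" "\<And>x. x \<in> S \<Longrightarrow> \<bar>x - a\<bar> < d \<Longrightarrow> F a \<le> F x"
    unfolding local_min_on_def by blast
  obtain e where e: "e > 0" "ball a e \<subseteq> S" using assms(1) d(1) by (meson openE)
  have "D = 0"
    by (rule DERIV_local_min[OF assms(2), of "min d e"])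
       (use d e in \<open>auto simp: subset_iff dist_real_def abs_minus_commute\<close>)
  thus False using assms(3) by simp
qed

lemma no_local_max_on:
  fixes F :: "real \<Rightarrow> real"
  assumes "open S" "(F has_field_derivative D) (at a)" "D \<noteq> 0"
  shows "\<not> local_max_on S F a"
  using no_local_min_on[OF assms(1) DERIV_minus[OF assms(2)]] assms(3) by (simp add: local_min_on_uminus)

text \<open>\<open>H\<close> stays negative near \<open>r\<close>, so \<open>F\<close> strictly
  increases before \<open>r\<close> and strictly decreases after it. Strictness also rules out a
  minimum, which the non-strict definitions would permit for a locally constant function.\<close>

lemma local_max_on_sign_change:
  fixes F H :: "real \<Rightarrow> real"
  assumes S: "open S" "r \<in> S"
    and F: "\<And>x. x \<in> S \<Longrightarrow> (F has_field_derivative (x - r) * H x) (at x)"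
    and H: "isCont H r" "H r < 0"
  shows "local_max_on S F r" "\<not> local_min_on S F r"
proof -
  have "eventually (\<lambda>x. H x < 0) (nhds r)"
    using H unfolding isCont_def tendsto_at_iff_tendsto_nhds by (rule order_tendstoD(2))
  moreover have "eventually (\<lambda>x. x \<in> S) (nhds r)" using S by (rule eventually_nhds_in_open)
  ultimately have "eventually (\<lambda>x. H x < 0 \<and> x \<in> S) (nhds r)" by (rule eventually_conj)
  then obtain d where d: "d > 0" "\<And>x. \<bar>x - r\<bar> < d \<Longrightarrow> H x < 0 \<and> x \<in> S"
    by (auto simp: eventually_nhds_metric dist_real_def)
  have less: "F x < F r" if x: "\<bar>x - r\<bar> < d" "x \<noteq> r" for x
  proof (cases "x < r")
    case True
    show ?thesis
    proof (rule DERIV_pos_imp_increasing_open[OF True])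
      fix y assume "x < y" "y < r"
      moreover from this x have "H y < 0 \<and> y \<in> S" by (intro d) auto
      ultimately show "\<exists>z. (F has_field_derivative z) (at y) \<and> z > 0"
        using F[of y] mult_neg_neg[of "y - r" "H y"] by (intro exI[of _ "(y - r) * H y"]) auto
    next
      show "continuous_on {x..r} F"
      proof (intro DERIV_continuous_on)
        fix y assume "y \<in> {x..r}"
        hence "y \<in> S" using x d(2)[of y] by auto
        thus "(F has_field_derivative (y - r) * H y) (at y within {x..r})"
          by (rule has_field_derivative_at_within[OF F])
      qed
    qed
  next
    case False
    hence *: "r < x" using x by simp
    show ?thesis
    proof (rule DERIV_neg_imp_decreasing_open[OF *])
      fix y assume "r < y" "y < x"
      moreover from this x have "H y < 0 \<and> y \<in> S" by (intro d) auto
      ultimately show "\<exists>z. (F has_field_derivative z) (at y) \<and> z < 0"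
        using F[of y] mult_pos_neg[of "y - r" "H y"] by (intro exI[of _ "(y - r) * H y"]) auto
    next
      show "continuous_on {r..x} F"
      proof (intro DERIV_continuous_on)
        fix y assume "y \<in> {r..x}"
        hence "y \<in> S" using x d(2)[of y] by auto
        thus "(F has_field_derivative (y - r) * H y) (at y within {r..x})"
          by (rule has_field_derivative_at_within[OF F])
      qed
    qed
  qed
  show "local_max_on S F r"
    unfolding local_max_on_def
  proof (intro conjI exI[of _ d] ballI impI)
    fix x assume "\<bar>x - r\<bar> < d"
    thus "F x \<le> F r" using less[of x] by (cases "x = r") auto
  qed (use S d in auto)
  show "\<not> local_min_on S F r"
  proof
    assume "local_min_on S F r"
    then obtain e where e: "e > 0" "\<And>x. x \<in> S \<Longrightarrow> \<bar>x - r\<bar> < e \<Longrightarrow> F r \<le> F x"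
      unfolding local_min_on_def by blast
    define x where "x = r + min d e / 2"
    have x: "\<bar>x - r\<bar> < d" "\<bar>x - r\<bar> < e" "x \<noteq> r" using d(1) e(1) by (auto simp: x_def)
    show False using e(2)[OF _ x(2)] less[OF x(1,3)] d(2)[OF x(1)] by auto
  qed
qed

lemma local_min_on_sign_change:
  fixes F H :: "real \<Rightarrow> real"
  assumes S: "open S" "r \<in> S"
    and F: "\<And>x. x \<in> S \<Longrightarrow> (F has_field_derivative (x - r) * H x) (at x)"
    and H: "isCont H r" "H r > 0"
  shows "local_min_on S F r" "\<not> local_max_on S F r"
proof -
  have "((\<lambda>x. - F x) has_field_derivative (x - r) * - H x) (at x)" if "x \<in> S" for x
    using DERIV_minus[OF F[OF that]] by simp
  from local_max_on_sign_change[OF S this] H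
  show "local_min_on S F r" "\<not> local_max_on S F r"
    by (simp_all add: local_min_on_uminus local_max_on_uminus)
qed

text \<open>Each element of \<open>R\<close> to the right of \<open>r\<close> contributes one
  negative factor.\<close>

lemma prod_diff_sign:
  fixes r :: real
  assumes "finite R" "r \<notin> R"
  shows "(\<Prod>s\<in>R. r - s) * (-1) ^ card {s \<in> R. r < s} > 0"
  using assms
proof (induction R)
  case (insert u R)
  let ?P = "\<Prod>s\<in>R. r - s" and ?c = "card {s \<in> R. r < s}"
  have prod: "(\<Prod>s\<in>insert u R. r - s) = (r - u) * ?P" using insert.hyps by simp
  have pos: "?P * (-1) ^ ?c > 0" using insert by simp
  have "{s \<in> insert u R. r < s} = (if r < u then insert u {s \<in> R. r < s} else {s \<in> R. r < s})"
    by auto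
  hence "card {s \<in> insert u R. r < s} = (if r < u then Suc ?c else ?c)" using insert.hyps by simp
  hence eq: "(\<Prod>s\<in>insert u R. r - s) * (-1) ^ card {s \<in> insert u R. r < s} = \<bar>r - u\<bar> * (?P * (-1) ^ ?c)"
    unfolding prod by (cases "r < u") (simp_all add: algebra_simps)
  show ?case unfolding eq by (rule mult_pos_pos[OF _ pos]) (use insert.prems in simp)
qed simp

text \<open>Removing the factor \<open>x - r\<close> leaves a function whose sign at
  \<open>r\<close> is given by \<open>prod_diff_sign\<close>, reversed by \<open>K\<close>. Outside
  \<open>R\<close> the derivative is nonzero, which excludes further extrema.\<close>

theorem local_extrema_simple_roots:
  fixes F K :: "real \<Rightarrow> real"
  assumes S: "open S" and R: "finite R" "R \<subseteq> S"
    and F: "\<And>x. x \<in> S \<Longrightarrow> (F has_field_derivative K x * (\<Prod>s\<in>R. x - s)) (at x)"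
    and K: "\<And>x. x \<in> S \<Longrightarrow> isCont K x" "\<And>x. x \<in> S \<Longrightarrow> K x < 0"
  shows "{a. local_max_on S F a} = {r \<in> R. even (card {s \<in> R. r < s})}"
    and "{a. local_min_on S F a} = {r \<in> R. odd (card {s \<in> R. r < s})}"
proof -
  have root: "local_max_on S F r \<longleftrightarrow> even (card {s \<in> R. r < s})"
    "local_min_on S F r \<longleftrightarrow> odd (card {s \<in> R. r < s})" if r: "r \<in> R" for r
  proof -
    define H where "H x = K x * (\<Prod>s\<in>R - {r}. x - s)" for x
    have rS: "r \<in> S" using r R by auto
    have F': "(F has_field_derivative (x - r) * H x) (at x)" if "x \<in> S" for x
      using F[OF that] prod.remove[OF R(1) r, of "\<lambda>s. x - s"] by (simp add: H_def mult_ac)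
    have cont: "isCont H r" unfolding H_def using K(1)[OF rS] by (intro continuous_intros)
    have "{s \<in> R - {r}. r < s} = {s \<in> R. r < s}" by auto
    hence sgn: "(\<Prod>s\<in>R - {r}. r - s) * (-1) ^ card {s \<in> R. r < s} > 0"
      using prod_diff_sign[of "R - {r}" r] R by simp
    show "local_max_on S F r \<longleftrightarrow> even (card {s \<in> R. r < s})"
      "local_min_on S F r \<longleftrightarrow> odd (card {s \<in> R. r < s})"
    proof -
      have "(local_max_on S F r \<longleftrightarrow> even (card {s \<in> R. r < s})) \<and>
        (local_min_on S F r \<longleftrightarrow> odd (card {s \<in> R. r < s}))"
      proof (cases "even (card {s \<in> R. r < s})")
        case True
        hence "H r < 0" using sgn K(2)[OF rS] by (simp add: H_def mult_less_0_iff)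
        from local_max_on_sign_change[OF S rS F' cont this] True show ?thesis by simp
      next
        case False
        hence "H r > 0" using sgn K(2)[OF rS] by (simp add: H_def zero_less_mult_iff)
        from local_min_on_sign_change[OF S rS F' cont this] False show ?thesis by simp
      qed
      thus "local_max_on S F r \<longleftrightarrow> even (card {s \<in> R. r < s})"
        "local_min_on S F r \<longleftrightarrow> odd (card {s \<in> R. r < s})" by simp_all
    qed
  qed
  have non: "\<not> local_max_on S F x \<and> \<not> local_min_on S F x" if "x \<in> S" "x \<notin> R" for x
  proof -
    have "K x * (\<Prod>s\<in>R. x - s) \<noteq> 0" using K(2)[OF that(1)] that(2) R(1) by auto
    thus ?thesis using no_local_min_on[OF S F[OF that(1)]] no_local_max_on[OF S F[OF that(1)]] by blast
  qed
  have mem: "x \<in> S" if "local_max_on S F x \<or> local_min_on S F x" for x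
    using that by (auto simp: local_max_on_def local_min_on_def)
  show "{a. local_max_on S F a} = {r \<in> R. even (card {s \<in> R. r < s})}"
    using root non mem by blast
  show "{a. local_min_on S F a} = {r \<in> R. odd (card {s \<in> R. r < s})}"
    using root non mem by blast
qed

section \<open>The seven critical points\<close>

lemma local_extrema_cong:
  assumes "\<And>x. x \<in> S \<Longrightarrow> F x = G x"
  shows "local_max_on S F = local_max_on S G" "local_min_on S F = local_min_on S G"
  using assms by (auto simp: local_max_on_def local_min_on_def fun_eq_iff)

text \<open>The points \<open>a_plus t\<close> and \<open>a_minus t\<close> are the roots of x(1-x)
  = -t; a root \<open>-t\<close> of a polynomial in x(1-x) thus yields a pair of critical
  points.\<close>

lemma half_sqrt_factor:
  fixes t x :: real
  assumes "1 + 4 * t \<ge> 0"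
  shows "(x - (1 / 2 + 1 / 2 * sqrt (1 + 4 * t))) * (x - (1 / 2 - 1 / 2 * sqrt (1 + 4 * t))) = - (x * (1 - x) + t)"
proof -
  have "(sqrt (1 + 4 * t))\<^sup>2 = 1 + 4 * t" using assms by simp
  thus ?thesis by (simp add: power2_eq_square algebra_simps)
qed


text \<open>To be used with \<open>e = n - 4\<close>. The last two claims are the factors of the two
  third derivatives, with \<open>T\<close> for x(1-x).\<close>

lemma root_inequalities:
  fixes e :: real
  assumes e: "e \<ge> 0"
  defines "s \<equiv> sqrt (3 * (e + 2) * (2 * e + 5))"
  defines "t1 \<equiv> (- (e + 2) * (2 * e + 5) - s) / (2 * (2 * e + 7) * (2 * e + 5))"
  defines "t2 \<equiv> (- (e + 2) * (2 * e + 5) + s) / (2 * (2 * e + 7) * (2 * e + 5))"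
  defines "t3 \<equiv> - ((e + 1) / (2 * (2 * e + 5)))"
  shows "- 1 / 4 < t1" "t1 < t3" "t3 < t2" "t2 < 0"
    and "(e + 1) - (4 * e + 10) * T = - (4 * e + 10) * (T + t3)"
    and "(e + 2) * (e + 1) - (e + 2) * (8 * e + 20) * T + (4 * e + 14) * (4 * e + 10) * T\<^sup>2
      = (4 * e + 14) * (4 * e + 10) * ((T + t1) * (T + t2))"
proof -
  define D where "D = 2 * (2 * e + 7) * (2 * e + 5)"
  have D: "D > 0" unfolding D_def using e by simp
  have s2: "s\<^sup>2 = 3 * (e + 2) * (2 * e + 5)" unfolding s_def using e by simp
  have t1: "t1 * D = - (e + 2) * (2 * e + 5) - s" and t2: "t2 * D = - (e + 2) * (2 * e + 5) + s"
    using D unfolding t1_def t2_def D_def[symmetric] by simp_all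
  have t3: "t3 * D = - (e + 1) * (2 * e + 7)"
    unfolding t3_def D_def using e by (simp add: field_simps)
  \<comment> \<open>After multiplication by \<open>D\<close> the inequalities become bounds on
    \<open>s\<close>: this one gives \<open>t3 < t2\<close>, as (e+2)(2e+5) and (e+1)(2e+7) differ
    by 3; \<open>s_lt\<close> gives \<open>- 1 / 4 < t1\<close>, and \<open>s_lt2\<close> gives
    \<open>t2 < 0\<close>.\<close>
  have s_gt: "3 < s" unfolding s_def
    by (rule real_less_rsqrt) (use e in \<open>auto simp: power2_eq_square algebra_simps intro!: add_pos_nonneg\<close>)
  have s_lt: "s < 3 * (2 * e + 5) / 2"
    unfolding s_def using e by (intro real_less_lsqrt) (auto simp: power2_eq_square field_simps intro!: add_pos_nonneg)
  have s_lt2: "s < (e + 2) * (2 * e + 5)"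
    unfolding s_def using e by (intro real_less_lsqrt) (auto simp: power2_eq_square field_simps intro!: add_pos_nonneg)
  have "(- 1 / 4) * D < t1 * D" "t1 * D < t3 * D" "t3 * D < t2 * D" "t2 * D < 0 * D"
    unfolding t1 t2 t3 using s_gt s_lt s_lt2 by (simp_all add: D_def algebra_simps)
  thus "- 1 / 4 < t1" "t1 < t3" "t3 < t2" "t2 < 0"
    using D by (simp_all only: mult_less_cancel_right_pos)
  show "(e + 1) - (4 * e + 10) * T = - (4 * e + 10) * (T + t3)"
    unfolding t3_def using e by (simp add: field_simps)
  \<comment> \<open>Clearing both denominators turns the product into a difference of squares, where
    \<open>s\<close> enters only as \<open>s^2\<close>.\<close>
  have "D * D * (T + t1) * (T + t2) = (D * T + t1 * D) * (D * T + t2 * D)" by (simp add: algebra_simps)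
  also have "\<dots> = (D * T - (e + 2) * (2 * e + 5))\<^sup>2 - s\<^sup>2"
    unfolding t1 t2 by (simp add: power2_eq_square algebra_simps)
  also have "\<dots> = (D * T)\<^sup>2 - 2 * (e + 2) * (2 * e + 5) * D * T + (e + 2) * (2 * e + 5) * ((e + 2) * (2 * e + 5) - 3)"
    unfolding s2 by (simp add: power2_eq_square algebra_simps)
  also have "\<dots> = (D / 2) * ((e + 2) * (e + 1) - (e + 2) * (8 * e + 20) * T + (4 * e + 14) * (4 * e + 10) * T\<^sup>2)"
    unfolding D_def by (simp add: power2_eq_square field_simps)
  finally have "D * D * (T + t1) * (T + t2) = (D / 2) * ((e + 2) * (e + 1) - (e + 2) * (8 * e + 20) * T
    + (4 * e + 14) * (4 * e + 10) * T\<^sup>2)" .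
  moreover have "D * D * (T + t1) * (T + t2) = (D / 2) * (2 * D * ((T + t1) * (T + t2)))" by simp
  ultimately have "(D / 2) * ((e + 2) * (e + 1) - (e + 2) * (8 * e + 20) * T + (4 * e + 14) * (4 * e + 10) * T\<^sup>2)
    = (D / 2) * (2 * D * ((T + t1) * (T + t2)))" by (rule trans[OF sym])
  hence "(e + 2) * (e + 1) - (e + 2) * (8 * e + 20) * T + (4 * e + 14) * (4 * e + 10) * T\<^sup>2
    = 2 * D * ((T + t1) * (T + t2))"
    by (rule mult_left_cancel[THEN iffD1, rotated]) (use D in simp)
  also have "2 * D = (4 * e + 14) * (4 * e + 10)" by (simp add: D_def algebra_simps)
  finally show "(e + 2) * (e + 1) - (e + 2) * (8 * e + 20) * T + (4 * e + 14) * (4 * e + 10) * T\<^sup>2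
      = (4 * e + 14) * (4 * e + 10) * ((T + t1) * (T + t2))" .
qed

theorem mainTheorem4:
  fixes n :: nat and t1 t2 t3 :: real and a_plus a_minus :: "real \<Rightarrow> real"
  assumes "n \<ge> 4"
    and "t1 = (- (real n - 2) * (2 * real n - 3) - sqrt (3 * (real n - 2) * (2 * real n - 3)))
              / (2 * (2 * real n - 1) * (2 * real n - 3))"
    and "t2 = (- (real n - 2) * (2 * real n - 3) + sqrt (3 * (real n - 2) * (2 * real n - 3)))
              / (2 * (2 * real n - 1) * (2 * real n - 3))"
    and "t3 = - ((real n - 3) / (2 * (2 * real n - 3)))"
    and "\<And>t. a_plus t = 1 / 2 + 1 / 2 * sqrt (1 + 4 * t)"
    and "\<And>t. a_minus t = 1 / 2 - 1 / 2 * sqrt (1 + 4 * t)"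
  shows "- 1 / 4 < t1 \<and> t1 < t3 \<and> t3 < t2 \<and> t2 < 0 \<and>
    {a. local_min_on {0<..<1} (\<lambda>a. (A n 3 a)\<^sup>2) a} = {1 / 2, a_plus t3, a_minus t3} \<and>
    {a. local_max_on {0<..<1} (\<lambda>a. (A n 3 a)\<^sup>2) a} =
      {a_plus t1, a_minus t1, a_plus t2, a_minus t2}"
proof -
  \<comment> \<open>The kernel has \<open>m = n - 1 = e + 3\<close>, so three differentiations leave
    the power \<open>e\<close> of x(1-x).\<close>
  define e where "e = n - 4"
  have n: "n = Suc (e + 3)" using assms(1) by (simp add: e_def)
  have re: "real n - 2 = real e + 2" "2 * real n - 3 = 2 * real e + 5" "2 * real n - 1 = 2 * real e + 7"
    "real n - 3 = real e + 1" by (simp_all add: n)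
  note t = assms(2-4)[unfolded re]
  note ineq = root_inequalities[of "real e", folded t, OF of_nat_0_le_iff]
  have ineq': "- 1 / 4 < t1" "t1 < t3" "t3 < t2" "t2 < 0"
    using ineq(1-4) .
  define d where "d t = 1 / 2 * sqrt (1 + 4 * t)" for t :: real
  \<comment> \<open>This order determines all counts below: from the right the critical points
    belong to \<open>t2\<close>, \<open>t3\<close>, \<open>t1\<close>, then 1/2, then the mirror
    images.\<close>
  have d: "0 < d t1" "d t1 < d t3" "d t3 < d t2" "d t2 < 1 / 2"
    using ineq' by (simp_all add: d_def real_less_lsqrt)
  have a: "a_plus t = 1 / 2 + d t" "a_minus t = 1 / 2 - d t" for t
    using assms(5,6) by (simp_all add: d_def)
  define R where "R = {1 / 2, 1 / 2 + d t1, 1 / 2 - d t1, 1 / 2 + d t2, 1 / 2 - d t2, 1 / 2 + d t3, 1 / 2 - d t3}"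
  \<comment> \<open>Collected constants: 2 from 1 - 2x = -2(x - 1/2), \<open>real e + 3\<close> once
    from each third derivative, \<open>real e + 2\<close> from the first one,
    \<open>4 * real e + 10\<close> from the linear and again from the quadratic factor,
    \<open>4 * real e + 14\<close> from the quadratic one.\<close>
  define C where "C = 2 * (real e + 3)\<^sup>2 * (real e + 2) * (4 * real e + 10)\<^sup>2 * (4 * real e + 14) / (fact (e + 3))\<^sup>2"
  define K where "K x = - C * ((x * (1 - x)) ^ e)\<^sup>2" for x
  have C: "C > 0" unfolding C_def by (intro divide_pos_pos mult_pos_pos) auto
  have der: "(kdiag (e + 3) 3 has_field_derivative K x * (\<Prod>s\<in>R. x - s)) (at x)" for x
  proof -
    define T where "T = x * (1 - x)"
    have pair: "(x - (1 / 2 + d t)) * (x - (1 / 2 - d t)) = - (T + t)" if "t \<ge> - 1 / 4" for t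
      unfolding d_def T_def using that by (intro half_sqrt_factor) simp
    have "(\<Prod>s\<in>R. x - s) = (x - 1 / 2) * ((x - (1 / 2 + d t1)) * (x - (1 / 2 - d t1)))
        * ((x - (1 / 2 + d t2)) * (x - (1 / 2 - d t2))) * ((x - (1 / 2 + d t3)) * (x - (1 / 2 - d t3)))"
      unfolding R_def using d by simp
    also have "\<dots> = (x - 1 / 2) * (- (T + t1)) * (- (T + t2)) * (- (T + t3))"
      using ineq' by (subst (1 2 3) pair) simp_all
    also have "\<dots> = - (x - 1 / 2) * ((T + t1) * (T + t2)) * (T + t3)" by algebra
    finally have prod: "(\<Prod>s\<in>R. x - s) = - (x - 1 / 2) * ((T + t1) * (T + t2)) * (T + t3)" .
    have "poly ((pderiv ^^ 3) (parabola ^ (e + 3))) x * poly ((pderiv ^^ 3) ([:1, -2:] * parabola ^ (e + 3))) x / (fact (e + 3))\<^sup>2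
      = K x * (\<Prod>s\<in>R. x - s)"
    proof -
      have ring: "(u * v * (- 2 * h) * P * (- w * z)) * (u * P * (y * w * q)) * i
          = - (2 * u\<^sup>2 * v * w\<^sup>2 * y * i) * P\<^sup>2 * (- h * q * z)" for u v h P w z y q i :: real
        by algebra
      have half: "1 - 2 * x = - 2 * (x - 1 / 2)" by simp
      show ?thesis
        unfolding pderiv3_parabola_power pderiv3_linear_parabola_power T_def[symmetric] ineq(5,6) prod K_def C_def
          half divide_inverse[of _ "(fact (e + 3))\<^sup>2"]
        by (rule ring)
    qed
    thus ?thesis using kdiag_has_field_derivative[of "e + 3" 3 x] unfolding parabola_def by simp
  qed
  have eq: "(A n 3 x)\<^sup>2 = kdiag (e + 3) 3 x" if "x \<in> {0<..<1}" for x
    using A_square_kernel[of 3 "e + 3" x] that by (simp add: n)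
  have K: "isCont K x" "K x < 0" if "x \<in> {0<..<1}" for x
    using that C by (auto simp: K_def[abs_def] intro!: continuous_intros mult_pos_pos)
  have R: "finite R" "R \<subseteq> {0<..<1}" using d by (auto simp: R_def)
  note ext = local_extrema_simple_roots[OF open_greaterThanLessThan R der K]
  \<comment> \<open>Unfolds a comprehension over an explicit set element by element, so that the
    inequalities \<open>d\<close> decide every cardinality.\<close>
  have filter: "{s \<in> insert y Y. P s} = (if P y then insert y {s \<in> Y. P s} else {s \<in> Y. P s})"
    "{s \<in> {}. P s} = {}" for y :: real and Y P by auto
  have max: "{r \<in> R. even (card {s \<in> R. r < s})} = {a_plus t1, a_minus t1, a_plus t2, a_minus t2}"
    unfolding R_def a filter using d by simp
  have min: "{r \<in> R. odd (card {s \<in> R. r < s})} = {1 / 2, a_plus t3, a_minus t3}"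
    unfolding R_def a filter using d by simp
  show ?thesis
    using ineq' ext max min local_extrema_cong[OF eq, of "{0<..<1}"] by simp
qed

end
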